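(* Let $A$ and $B$ be subsets of $\mathbb{N}$ such that $\underline{\operatorname{d}}(A)=\alpha>0$ and $\underline{\operatorname{d}}(B)=\beta>0$. Then $A+B$ is strongly upper syndetic of level $\min\{\alpha+\beta,1\}$.
   Context: Intervals denote intervals of integers, $\mathbb{N}$ does not contain $0$, and $A+B=\{a+b:a\in A,b\in B\}$. The dimension is $1$ and densities are taken over initial intervals $[1,n]$: for $A\subseteq\mathbb{N}$, $\underline{\operatorname{d}}(A)=\liminf_{n\to\infty}\frac{|A\cap[1,n]|}{n}$. For a real number $0<\gamma\le 1$, a set $C\subseteq\mathbb{N}$ is strongly upper syndetic of level $\gamma$ if for every infinite sequence (infinite set) $S\subseteq\mathbb{N}$ there exists a natural number $m$ (with $m=0$ allowed) such that for every $k\in\mathbb{N}$, $$\limsup_{n\in S,\ n\to\infty}\frac{1}{n}\left|\{z\in[1,n]: z+[-k,k]\subseteq C+[-m,m]\}\right|\ge\gamma.$$ *)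

theory Defs
  imports "HOL-Library.Set_Algebras" "HOL-Library.Extended_Real" "HOL-Library.Liminf_Limsup"
begin

text \<open>
  Subsets of \<open>\<nat> = {1, 2, \<dots>}\<close> are sets of integers contained in \<open>{1..}\<close>, so that they can be
  added to intervals \<open>[-m, m]\<close>. Sums of sets, and of a number and a set (\<open>+o\<close>), are those of
  \<^theory>\<open>HOL-Library.Set_Algebras\<close>. Limits inferior and superior are taken in the extended reals,
  where they always exist.
\<close>

definition lower_density :: "int set \<Rightarrow> ereal" where
  "lower_density A = liminf (\<lambda>n. ereal (real (card (A \<inter> {1..int n})) / real n))"

text \<open>The filter of \<open>n \<rightarrow> \<infinity>\<close> with \<open>n \<in> S\<close> is \<open>inf sequentially (principal S)\<close>.\<close>

definition strongly_upper_syndetic :: "real \<Rightarrow> int set \<Rightarrow> bool" where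
  "strongly_upper_syndetic \<gamma> C \<longleftrightarrow>
     0 < \<gamma> \<and> \<gamma> \<le> 1 \<and> C \<subseteq> {1..} \<and>
     (\<forall>S::nat set. infinite S \<and> S \<subseteq> {1..} \<longrightarrow>
       (\<exists>m::nat. \<forall>k::nat. k \<ge> 1 \<longrightarrow>
         Limsup (inf sequentially (principal S))
           (\<lambda>n. ereal (1 / real n *
              real (card {z \<in> {1..int n}. z +o {- int k..int k} \<subseteq> C + {- int m..int m}})))
         \<ge> ereal \<gamma>))"

end

theory Submission imports Defs begin

text \<open>
  Thickening A by growing intervals [-m, m] increases its density in [1, n], so for m large
  further thickening by any fixed L hardly matters. Cut [1, n] into blocks of length L: then nearly all
  blocks that A meets are almost filled by A + [-m, m], and likewise for B. If blocks i and j are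
  almost filled by the thickened A and B, then blocks i + j and i + j + 1 are, up to their ends, contained in
  A + B + [-2m, 2m]. Mann's theorem for the sets of filled blocks gives the density
  \<open>\<alpha> + \<beta>\<close> up to an arbitrarily small error.

  The error has to be absorbed with m fixed. Suppose \<open>\<alpha> + \<beta> < 1\<close>. If thickening increases
  the sum of the densities beyond \<open>\<alpha> + \<beta>\<close>, one of the sets, say A, has density above
  \<open>\<alpha> + 2\<eta>\<close> in [1, n]. Starting at the minimum of \<open>|A \<inter> [1, x]| - (\<alpha> + \<eta>) x\<close>, Mann's theorem
  applies with slope \<open>\<alpha> + \<eta>\<close> and yields a definite gain exceeding the error. Otherwise m = 0 already
  works for every error. If \<open>\<alpha> + \<beta> \<ge> 1\<close>, let z be the last point where the counts of A + [-1, 1]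
  and B + [-1, 1] add up to z, up to a tiny error. Beyond z the pigeonhole principle puts every
  point into A + B + [-2, 2]. Up to z thickening by 1, hence by any L, hardly matters, so m = 0 works.
\<close>

section \<open>Mann's theorem\<close>

text \<open>The elements of A below b and the translate b + (A \<inter> [0, r]) are disjoint parts
  of A; the extra 1 counts b itself, the translate of 0.\<close>

lemma mann_step_count:
  fixes A :: "nat set" and b r :: nat
  assumes "b \<ge> 1" "(\<lambda>x. b + x) ` (A \<inter> {0..r}) \<subseteq> A" "0 \<in> A"
  shows "card (A \<inter> {1..b + r}) \<ge> card (A \<inter> {1..b - 1}) + 1 + card (A \<inter> {1..r})"
proof -
  have "A \<inter> {0..r} = insert 0 (A \<inter> {1..r})" using assms(3) by auto
  then have "card (A \<inter> {0..r}) = 1 + card (A \<inter> {1..r})" by simp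
  moreover have "card ((\<lambda>x. b + x) ` (A \<inter> {0..r})) = card (A \<inter> {0..r})"
    by (rule card_image) auto
  moreover have "card ((A \<inter> {1..b - 1}) \<union> (\<lambda>x. b + x) ` (A \<inter> {0..r}))
      = card (A \<inter> {1..b - 1}) + card ((\<lambda>x. b + x) ` (A \<inter> {0..r}))"
    using assms(1) by (intro card_Un_disjoint) auto
  moreover have "card ((A \<inter> {1..b - 1}) \<union> (\<lambda>x. b + x) ` (A \<inter> {0..r})) \<le> card (A \<inter> {1..b + r})"
    using assms by (intro card_mono) (auto simp: subset_iff)
  ultimately show ?thesis by simp
qed

text \<open>An outer induction on n and, for fixed n, an inner one on the number of elements of B in
  [1, n]. If A absorbs B up to n, the bound is read off A alone; otherwise a transform moves
  elements of B, shifted, into A.\<close>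

lemma mann:
  fixes A B :: "nat set" and \<gamma> :: real
  assumes "\<gamma> \<le> 1" "0 \<in> A" "0 \<in> B"
    and "\<And>m. 1 \<le> m \<Longrightarrow> m \<le> n \<Longrightarrow> \<gamma> * m \<le> card (A \<inter> {1..m}) + card (B \<inter> {1..m})"
  shows "\<gamma> * n \<le> card ((A + B) \<inter> {1..n})"
  using assms(2-)
proof (induction n arbitrary: A B rule: less_induct)
  case (less n)
  note outer = less.IH
  show ?case using less.prems
  proof (induction "card (B \<inter> {1..n})" arbitrary: A B rule: less_induct)
    case (less B A)
    note zA = less.prems(1) and zB = less.prems(2) and dens = less.prems(3)
    \<comment> \<open>On [1, m - b] the set A + B coincides with A, so the outer induction gives A
      slope \<gamma> there. Copying this stretch behind b and using the hypothesis on [1, b - 1]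
      covers [1, m] except b, which pays for itself since \<gamma> \<le> 1.\<close>
    have step: "\<gamma> * m \<le> card (A \<inter> {1..m}) + card (B \<inter> {1..b - 1})"
      if b: "b \<in> B" "1 \<le> b" "b \<le> m" "m \<le> n"
        and closed: "\<And>a b'. a \<in> A \<Longrightarrow> b' \<in> B \<Longrightarrow> a \<le> m - b \<Longrightarrow> a + b' \<le> n \<Longrightarrow> a + b' \<in> A"
      for m b
    proof -
      let ?r = "m - b"
      have "(A + B) \<inter> {1..?r} = A \<inter> {1..?r}"
      proof (intro equalityI subsetI)
        fix x assume "x \<in> (A + B) \<inter> {1..?r}"
        then obtain a' b' where "a' \<in> A" "b' \<in> B" "x = a' + b'" "1 \<le> x" "x \<le> ?r"
          by (auto elim!: set_plus_elim)
        then show "x \<in> A \<inter> {1..?r}" using closed[of a' b'] that by auto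
      next
        fix x assume "x \<in> A \<inter> {1..?r}"
        then show "x \<in> (A + B) \<inter> {1..?r}" using set_plus_intro[OF _ zB, of x A] by auto
      qed
      moreover have "\<gamma> * ?r \<le> card ((A + B) \<inter> {1..?r})"
        using that by (intro outer zA zB dens) auto
      ultimately have r: "\<gamma> * ?r \<le> card (A \<inter> {1..?r})" by simp
      have "(\<lambda>x. b + x) ` (A \<inter> {0..?r}) \<subseteq> A"
        using closed[of _ b] b by (auto simp: add.commute)
      from mann_step_count[OF b(2) this zA] b
      have "card (A \<inter> {1..m}) \<ge> card (A \<inter> {1..b - 1}) + 1 + card (A \<inter> {1..?r})" by simp
      moreover have "\<gamma> * (b - 1) \<le> card (A \<inter> {1..b - 1}) + card (B \<inter> {1..b - 1})"
        using dens[of "b - 1"] b by (cases "b = 1") auto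
      moreover have "\<gamma> * m = \<gamma> * ?r + \<gamma> * (b - 1) + \<gamma>" using b
        by (simp add: of_nat_diff algebra_simps)
      ultimately show ?thesis using r assms(1) by linarith
    qed
    show ?case
    proof (cases "\<exists>a\<in>A. \<exists>b\<in>B. a + b \<le> n \<and> a + b \<notin> A")
      case False
      have "A \<inter> {1..n} \<subseteq> (A + B) \<inter> {1..n}"
        using set_plus_intro[OF _ zB, of _ A] by force
      then have le: "card (A \<inter> {1..n}) \<le> card ((A + B) \<inter> {1..n})" by (intro card_mono) auto
      have "\<gamma> * n \<le> card (A \<inter> {1..n})"
      proof (cases "B \<inter> {1..n} = {}")
        case True
        then show ?thesis using dens[of n] by (cases "n = 0") auto
      next
        case nonempty: False
        \<comment> \<open>With b the least positive element of B, \<open>step\<close> at m = n has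
          no contribution from B.\<close>
        define b where "b = Min (B \<inter> {1..n})"
        have b: "b \<in> B \<inter> {1..n}" unfolding b_def using nonempty by (intro Min_in) auto
        have "B \<inter> {1..b - 1} = {}"
        proof (rule ccontr)
          assume "B \<inter> {1..b - 1} \<noteq> {}"
          then obtain x where "x \<in> B" "1 \<le> x" "x < b" by fastforce
          moreover have "b \<le> x" unfolding b_def using calculation b by (intro Min_le) auto
          ultimately show False by simp
        qed
        then show ?thesis using step[of b n] b False by auto
      qed
      with le show ?thesis by linarith
    next
      case True
      \<comment> \<open>Dyson's transform at a, which keeps A + B up to n and shrinks B. It preserves the density
        bounds because, a being minimal, A + B agrees with A below a, where the bound for smaller n applies.\<close>
      define a where "a = (LEAST a. a \<in> A \<and> (\<exists>b\<in>B. a + b \<le> n \<and> a + b \<notin> A))"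
      have a: "a \<in> A" "\<exists>b\<in>B. a + b \<le> n \<and> a + b \<notin> A"
        unfolding a_def using True LeastI_ex[of "\<lambda>a. a \<in> A \<and> (\<exists>b\<in>B. a + b \<le> n \<and> a + b \<notin> A)"] by blast+
      have closed: "a' + b \<in> A" if "a' \<in> A" "b \<in> B" "a' < a" "a' + b \<le> n" for a' b
        using that not_less_Least[of a' "\<lambda>a. a \<in> A \<and> (\<exists>b\<in>B. a + b \<le> n \<and> a + b \<notin> A)"]
        unfolding a_def by blast
      define D where "D = {b \<in> B. a + b \<le> n \<and> a + b \<notin> A}"
      define A' where "A' = A \<union> (\<lambda>b. a + b) ` D"
      define B' where "B' = B - D"
      have zD: "0 \<notin> D" using a by (simp add: D_def)
      have "B' \<inter> {1..n} \<subset> B \<inter> {1..n}"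
      proof -
        obtain b where b: "b \<in> B" "a + b \<le> n" "a + b \<notin> A" using a by auto
        then have "b \<noteq> 0" using a by (metis add.right_neutral)
        then have "b \<in> B \<inter> {1..n}" "b \<notin> B'" using b by (auto simp: B'_def D_def)
        moreover have "B' \<subseteq> B" by (simp add: B'_def)
        ultimately show ?thesis by blast
      qed
      then have "card (B' \<inter> {1..n}) < card (B \<inter> {1..n})" by (intro psubset_card_mono) auto
      moreover have "\<gamma> * m \<le> card (A' \<inter> {1..m}) + card (B' \<inter> {1..m})" if m: "1 \<le> m" "m \<le> n" for m
      proof -
        have cA: "card (A' \<inter> {1..m}) \<ge> card (A \<inter> {1..m}) + card (D \<inter> {1..m - a})"
        proof -
          have "card ((A \<inter> {1..m}) \<union> (\<lambda>b. a + b) ` (D \<inter> {1..m - a})) \<le> card (A' \<inter> {1..m})"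
            by (intro card_mono) (auto simp: A'_def)
          moreover have "card ((A \<inter> {1..m}) \<union> (\<lambda>b. a + b) ` (D \<inter> {1..m - a}))
            = card (A \<inter> {1..m}) + card ((\<lambda>b. a + b) ` (D \<inter> {1..m - a}))"
            by (intro card_Un_disjoint) (auto simp: D_def)
          moreover have "card ((\<lambda>b. a + b) ` (D \<inter> {1..m - a})) = card (D \<inter> {1..m - a})"
            by (rule card_image) auto
          ultimately show ?thesis by simp
        qed
        have cB: "card (B \<inter> {1..x}) = card (B' \<inter> {1..x}) + card (D \<inter> {1..x})" for x
          by (subst card_Un_disjoint[symmetric]) (auto simp: B'_def D_def intro!: arg_cong[where f = card])
        show ?thesis
        \<comment> \<open>If B avoids (m - a, m], the elements removed from B up to m are matched by
          translates a + D in [1, m]. Otherwise \<open>step\<close> applies at the first b in that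
          window: a' \<le> m - b implies a' < a, and the elements of B below b all lie in
          [0, m - a].\<close>
        proof (cases "B \<inter> {m - a<..m} = {}")
          case True
          have "x \<in> {1..m - a}" if "x \<in> D" "x \<in> {1..m}" for x
          proof -
            have "x \<notin> {m - a<..m}" using True that by (auto simp: D_def)
            with that show ?thesis by auto
          qed
          then have "D \<inter> {1..m} = D \<inter> {1..m - a}" by auto
          then have "card (D \<inter> {1..m}) = card (D \<inter> {1..m - a})" by (rule arg_cong)
          then show ?thesis using cA cB[of m] dens[OF m] by linarith
        next
          case False
          define b where "b = Min (B \<inter> {m - a<..m})"
          have b: "b \<in> B \<inter> {m - a<..m}" unfolding b_def using False by (intro Min_in) auto
          have "B \<inter> {1..b - 1} = B \<inter> {1..m - a}"
          proof (rule ccontr)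
            assume "B \<inter> {1..b - 1} \<noteq> B \<inter> {1..m - a}"
            then obtain x where "x \<in> B" "m - a < x" "x < b" using b by fastforce
            moreover have "b \<le> x" unfolding b_def using calculation b by (intro Min_le) auto
            ultimately show False by simp
          qed
          then have "card (B \<inter> {1..b - 1}) = card (B \<inter> {1..m - a})" by (rule arg_cong)
          moreover have "card (B' \<inter> {1..m}) \<ge> card (B' \<inter> {1..m - a})" by (intro card_mono) auto
          moreover have "\<gamma> * m \<le> card (A \<inter> {1..m}) + card (B \<inter> {1..b - 1})"
          proof (rule step[of b m])
            fix a' b' assume "a' \<in> A" "b' \<in> B" "a' \<le> m - b" "a' + b' \<le> n"
            moreover have "a' < a" using calculation(3) b by auto
            ultimately show "a' + b' \<in> A" by (intro closed)
          qed (use b m in auto)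
          ultimately show ?thesis using cA cB[of "m - a"] by linarith
        qed
      qed
      ultimately have "\<gamma> * n \<le> card ((A' + B') \<inter> {1..n})"
        using zA zB zD by (intro less.hyps) (auto simp: A'_def B'_def)
      moreover have "(A' + B') \<inter> {1..n} \<subseteq> (A + B) \<inter> {1..n}"
      proof
        fix x assume "x \<in> (A' + B') \<inter> {1..n}"
        then obtain y z where x: "x = y + z" "y \<in> A'" "z \<in> B" "z \<notin> D" "x \<in> {1..n}"
          by (auto elim!: set_plus_elim simp: B'_def)
        show "x \<in> (A + B) \<inter> {1..n}"
        proof (cases "y \<in> A")
          case True
          then show ?thesis using x by (auto intro: set_plus_intro)
        next
          case False
          \<comment> \<open>An exchange: z is in B but not in D, so a + z is in A, and the removed d
            serves as the summand from B.\<close>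
          then obtain d where d: "d \<in> D" "y = a + d" using x by (auto simp: A'_def)
          then have "a + z \<in> A" using x by (auto simp: D_def)
          moreover have "d \<in> B" using d by (simp add: D_def)
          ultimately have "(a + z) + d \<in> A + B" by (rule set_plus_intro)
          then show ?thesis using x d by (simp add: ac_simps)
        qed
      qed
      then have "card ((A' + B') \<inter> {1..n}) \<le> card ((A + B) \<inter> {1..n})" by (intro card_mono) auto
      ultimately show ?thesis by linarith
    qed
  qed
qed

section \<open>Sumsets of sets of blocks\<close>

text \<open>Offsets from a and b are raised by 1, which turns the windows into [1, y] and makes room
  for the 0 that \<open>mann\<close> requires. Two positive lifted summands carry one unit too many
  on the way back, whence {0, 1}; if one of them is 0, then a or b takes its place.\<close>

lemma mann_shifted:
  fixes E F :: "nat set" and \<gamma> :: real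
  assumes "\<gamma> \<le> 1" "a \<in> E" "b \<in> F"
    and dens: "\<And>y. y \<le> n \<Longrightarrow> \<gamma> * y \<le> card (E \<inter> {a..<a + y}) + card (F \<inter> {b..<b + y})"
  shows "\<gamma> * n \<le> card ((E + F + {0, 1}) \<inter> {a + b..<a + b + n})"
proof -
  let ?lift = "\<lambda>c X. insert 0 ((\<lambda>x. Suc x - c) ` (X \<inter> {c..}))"
  have count: "card (?lift c X \<inter> {1..m}) = card (X \<inter> {c..<c + m})" for c m and X :: "nat set"
  proof -
    have "?lift c X \<inter> {1..m} = (\<lambda>x. Suc x - c) ` (X \<inter> {c..<c + m})" by auto
    moreover have "inj_on (\<lambda>x. Suc x - c) (X \<inter> {c..<c + m})" by (auto simp: inj_on_def)
    ultimately show ?thesis by (simp add: card_image)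
  qed
  have "\<gamma> * n \<le> card ((?lift a E + ?lift b F) \<inter> {1..n})"
    using assms(1) by (intro mann) (use dens in \<open>auto simp del: Int_insert_left_if0 simp: count[simplified]\<close>)
  moreover have "(\<lambda>x. a + b + x - 1) ` ((?lift a E + ?lift b F) \<inter> {1..n}) \<subseteq>
      (E + F + {0, 1}) \<inter> {a + b..<a + b + n}"
  proof
    fix z assume "z \<in> (\<lambda>x. a + b + x - 1) ` ((?lift a E + ?lift b F) \<inter> {1..n})"
    then obtain w where w: "w \<in> ?lift a E + ?lift b F" "1 \<le> w" "w \<le> n" "z = a + b + w - 1"
      by fastforce
    from w(1) obtain x y where "x \<in> ?lift a E" "y \<in> ?lift b F" "w = x + y"
      by (rule set_plus_elim)
    with w have xy: "x \<in> ?lift a E" "y \<in> ?lift b F" "z = a + b + (x + y) - 1"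
        "1 \<le> x + y" "x + y \<le> n" by auto
    have mem: "e + f + d \<in> E + F + {0, 1}" if "e \<in> E" "f \<in> F" "d \<in> {0, 1}" for e f d :: nat
      using that by (intro set_plus_intro)
    have x: "x = 0 \<or> (\<exists>e\<in>E. a \<le> e \<and> x = Suc e - a)" and y: "y = 0 \<or> (\<exists>f\<in>F. b \<le> f \<and> y = Suc f - b)"
      using xy by auto
    have "z \<in> E + F + {0, 1}"
    proof (cases "x = 0 \<or> y = 0")
      case True
      then obtain e f where "e \<in> E" "f \<in> F" "z = e + f + 0"
        using x y xy assms(2,3) by fastforce
      then show ?thesis using mem[of e f 0] by simp
    next
      case False
      then obtain e f where "e \<in> E" "f \<in> F" "z = e + f + 1"
        using x y xy by fastforce
      then show ?thesis using mem[of e f 1] by simp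
    qed
    then show "z \<in> (E + F + {0, 1}) \<inter> {a + b..<a + b + n}" using xy by auto
  qed
  then have "card ((\<lambda>x. a + b + x - 1) ` ((?lift a E + ?lift b F) \<inter> {1..n})) \<le>
      card ((E + F + {0, 1}) \<inter> {a + b..<a + b + n})" by (intro card_mono) auto
  moreover have "card ((\<lambda>x. a + b + x - 1) ` ((?lift a E + ?lift b F) \<inter> {1..n})) =
      card ((?lift a E + ?lift b F) \<inter> {1..n})"
    by (intro card_image) (auto simp: inj_on_def)
  ultimately show ?thesis by linarith
qed

lemma card_Int_split:
  fixes E :: "nat set"
  assumes "x \<le> y"
  shows "card (E \<inter> {..<y}) = card (E \<inter> {..<x}) + card (E \<inter> {x..<y})"
proof -
  have "E \<inter> {..<y} = (E \<inter> {..<x}) \<union> (E \<inter> {x..<y})" using assms by auto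
  then show ?thesis by (simp add: card_Un_disjoint disjoint_iff)
qed

text \<open>Take a minimising |E \<inter> [0, x)| - p x on [0, H]. Comparison with x = 0 bounds the
  count before a, comparison with later x gives slope p from a on, and one step of positive slope
  forces a into E.\<close>

lemma rising_start:
  fixes E :: "nat set" and p :: real and H :: nat
  shows "\<exists>a\<le>H. card (E \<inter> {..<a}) \<le> p * a \<and>
    (\<forall>y. a + y \<le> H \<longrightarrow> p * y \<le> card (E \<inter> {a..<a + y})) \<and> (0 < p \<longrightarrow> a < H \<longrightarrow> a \<in> E)"
proof -
  define f where "f x = card (E \<inter> {..<x}) - p * x" for x
  define a where "a = arg_min_on f {..H}"
  have a: "a \<le> H" "\<And>x. x \<le> H \<Longrightarrow> f a \<le> f x"
    using arg_min_if_finite[of "{..H}" f] arg_min_least[of "{..H}" _ f] unfolding a_def by auto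
  have 0: "card (E \<inter> {..<a}) \<le> p * a" using a(2)[of 0] by (simp add: f_def)
  have y: "p * y \<le> card (E \<inter> {a..<a + y})" if "a + y \<le> H" for y
    using a(2)[OF that] card_Int_split[of a "a + y" E] by (simp add: f_def algebra_simps)
  have "a \<in> E" if "0 < p" "a < H"
  proof (rule ccontr)
    assume "a \<notin> E"
    then have "E \<inter> {a..<a + 1} = {}" by (auto simp: less_Suc_eq)
    then show False using y[of 1] that by simp
  qed
  with a(1) 0 y show ?thesis by blast
qed

text \<open>For slopes lowered by \<tau>, the error \<open>\<tau>\<^sup>2 * H\<close> forces the
  starting points a and b below \<tau> H; this is why it is quadratic in \<tau>.
  \<open>mann_shifted\<close> covers the rest, and the first a + b places cost at most 2 \<tau>
  H.\<close>

lemma block_sumset_count: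
  fixes E F :: "nat set" and \<alpha> \<beta> \<tau> :: real and H X :: nat
  assumes "0 < \<tau>" "\<tau> < \<alpha>" "\<tau> < \<beta>"
    and E: "\<And>x. x \<le> H \<Longrightarrow> \<alpha> * x - \<tau>\<^sup>2 * H \<le> card (E \<inter> {..<x})"
    and F: "\<And>x. x \<le> H \<Longrightarrow> \<beta> * x - \<tau>\<^sup>2 * H \<le> card (F \<inter> {..<x})"
    and "X \<le> H"
  shows "(min (\<alpha> + \<beta>) 1 - 2 * \<tau>) * X - 2 * \<tau> * H \<le> card ((E + F + {0, 1}) \<inter> {..<X})"
proof -
  obtain a where a: "a \<le> H" "card (E \<inter> {..<a}) \<le> (\<alpha> - \<tau>) * a"
    "\<And>y. a + y \<le> H \<Longrightarrow> (\<alpha> - \<tau>) * y \<le> card (E \<inter> {a..<a + y})" "0 < \<alpha> - \<tau> \<Longrightarrow> a < H \<Longrightarrow> a \<in> E"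
    using rising_start[of H E "\<alpha> - \<tau>"] by blast
  obtain b where b: "b \<le> H" "card (F \<inter> {..<b}) \<le> (\<beta> - \<tau>) * b"
    "\<And>y. b + y \<le> H \<Longrightarrow> (\<beta> - \<tau>) * y \<le> card (F \<inter> {b..<b + y})" "0 < \<beta> - \<tau> \<Longrightarrow> b < H \<Longrightarrow> b \<in> F"
    using rising_start[of H F "\<beta> - \<tau>"] by blast
  have "\<tau> * a \<le> \<tau> * (\<tau> * H)" "\<tau> * b \<le> \<tau> * (\<tau> * H)"
    using E[OF a(1)] a(2) F[OF b(1)] b(2) by (auto simp: algebra_simps power2_eq_square)
  then have small: "a \<le> \<tau> * H" "b \<le> \<tau> * H" using assms(1) by auto
  define \<gamma> where "\<gamma> = min (\<alpha> + \<beta>) 1 - 2 * \<tau>"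
  have \<gamma>: "\<gamma> \<le> 1" "\<gamma> \<le> (\<alpha> - \<tau>) + (\<beta> - \<tau>)" using assms by (auto simp: \<gamma>_def)
  show ?thesis
  proof (cases "a + b < X")
    case False
    then have "X \<le> a + b" by simp
    then have "real X \<le> 2 * \<tau> * H" using small by linarith
    moreover have "\<gamma> * X \<le> 1 * real X" using \<gamma> by (intro mult_right_mono) auto
    ultimately show ?thesis unfolding \<gamma>_def[symmetric] by simp
  next
    case True
    define n where "n = X - a - b"
    have "\<gamma> * n \<le> card ((E + F + {0, 1}) \<inter> {a + b..<a + b + n})"
    proof (rule mann_shifted)
      fix y assume "y \<le> n"
      then have "a + y \<le> H" "b + y \<le> H" using True assms(6) by (auto simp: n_def)
      moreover have "\<gamma> * y \<le> ((\<alpha> - \<tau>) + (\<beta> - \<tau>)) * y" using \<gamma> by (intro mult_right_mono) auto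
      ultimately show "\<gamma> * y \<le> card (E \<inter> {a..<a + y}) + card (F \<inter> {b..<b + y})"
        using a(3)[of y] b(3)[of y]
        unfolding distrib_right[of "\<alpha> - \<tau>"] of_nat_add by linarith
    qed (use \<gamma> a(1,4) b(1,4) True assms(2,3,6) in auto)
    also have "\<dots> \<le> card ((E + F + {0, 1}) \<inter> {..<X})"
      using True by (intro of_nat_mono card_mono) (auto simp: n_def)
    finally have "\<gamma> * n \<le> card ((E + F + {0, 1}) \<inter> {..<X})" .
    moreover have "\<gamma> * X = \<gamma> * n + \<gamma> * (a + b)" using True by (simp add: n_def of_nat_diff algebra_simps)
    moreover have "\<gamma> * (a + b) \<le> 1 * real (a + b)" using \<gamma> by (intro mult_right_mono) auto
    ultimately show ?thesis unfolding \<gamma>_def[symmetric] using small by simp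
  qed
qed

text \<open>The raised slope \<alpha> + \<eta> may start late, but the surplus 2 \<eta> at H leaves
  H - a at least (\<eta> - \<tau>) H. On that final stretch Mann's bound gains \<eta> per place,
  about \<open>\<eta>\<^sup>2 * H\<close> in total; before it \<open>block_sumset_count\<close> is
  used.\<close>

lemma block_sumset_count_gain:
  fixes E F :: "nat set" and \<alpha> \<beta> \<tau> \<eta> :: real and H :: nat
  assumes "0 < \<tau>" "\<tau> < \<alpha>" "\<tau> < \<beta>"
    and E: "\<And>x. x \<le> H \<Longrightarrow> \<alpha> * x - \<tau>\<^sup>2 * H \<le> card (E \<inter> {..<x})"
    and F: "\<And>x. x \<le> H \<Longrightarrow> \<beta> * x - \<tau>\<^sup>2 * H \<le> card (F \<inter> {..<x})"
    and \<eta>: "0 < \<eta>" "\<alpha> + \<beta> + \<eta> \<le> 1"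
    and gain: "(\<alpha> + 2 * \<eta>) * H - \<tau>\<^sup>2 * H \<le> card (E \<inter> {..<H})"
  shows "(\<alpha> + \<beta> + \<eta>\<^sup>2 - 8 * \<tau>) * H \<le> card ((E + F + {0, 1}) \<inter> {..<H})"
proof -
  let ?T = "E + F + {0, 1}"
  have \<tau>1: "\<tau> < 1" "\<eta> < 1" using assms by linarith+
  have sq: "\<tau>\<^sup>2 * H \<le> \<tau> * H"
    using \<tau>1 assms(1) by (intro mult_right_mono) (auto simp: power2_eq_square)
  have \<eta>sq: "\<eta>\<^sup>2 * H \<le> \<eta> * H"
    using \<tau>1 \<eta>(1) by (intro mult_right_mono) (auto simp: power2_eq_square)
  have H0: "\<tau> * H \<ge> 0" using assms by simp
  obtain a where a: "a \<le> H" "card (E \<inter> {..<a}) \<le> (\<alpha> + \<eta>) * a"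
    "\<And>y. a + y \<le> H \<Longrightarrow> (\<alpha> + \<eta>) * y \<le> card (E \<inter> {a..<a + y})" "0 < \<alpha> + \<eta> \<Longrightarrow> a < H \<Longrightarrow> a \<in> E"
    using rising_start[of H E "\<alpha> + \<eta>"] by blast
  obtain b where b: "b \<le> H" "card (F \<inter> {..<b}) \<le> (\<beta> - \<tau>) * b"
    "\<And>y. b + y \<le> H \<Longrightarrow> (\<beta> - \<tau>) * y \<le> card (F \<inter> {b..<b + y})" "0 < \<beta> - \<tau> \<Longrightarrow> b < H \<Longrightarrow> b \<in> F"
    using rising_start[of H F "\<beta> - \<tau>"] by blast
  have "\<tau> * b \<le> \<tau> * (\<tau> * H)"
    using F[OF b(1)] b(2) by (auto simp: algebra_simps power2_eq_square)
  then have small: "b \<le> \<tau> * H" using assms(1) by auto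
  have "card (E \<inter> {a..<H}) \<le> card {a..<H}" by (intro card_mono) auto
  then have "card (E \<inter> {..<H}) \<le> (\<alpha> + \<eta>) * a + (real H - a)"
    using card_Int_split[of a H E] a by (simp add: of_nat_diff)
  moreover have "(\<alpha> + \<eta>) * (real H - a) \<ge> 0" using a \<eta> assms by simp
  ultimately have room: "real H - a \<ge> \<eta> * H - \<tau> * H"
    using gain sq by (simp add: algebra_simps)
  have base: "(\<alpha> + \<beta> - 2 * \<tau>) * X - 2 * \<tau> * H \<le> card (?T \<inter> {..<X})" if "X \<le> H" for X
    using block_sumset_count[OF assms(1-3) E F that] \<eta> by simp
  show ?thesis
  proof (cases "a + b < H")
    case False
    then have "\<eta> * H \<le> 2 * \<tau> * H" using room small a by linarith
    then have "\<eta>\<^sup>2 * H \<le> 2 * (\<tau> * H)" using \<eta>sq by linarith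
    then show ?thesis using base[of H] H0 by (simp add: left_diff_distrib distrib_right)
  next
    case True
    define n where "n = H - a - b"
    have n: "real n = real H - a - b" using True by (simp add: n_def of_nat_diff)
    have "(\<alpha> + \<beta> + \<eta> - \<tau>) * n \<le> card (?T \<inter> {a + b..<a + b + n})"
    proof (rule mann_shifted)
      fix y assume "y \<le> n"
      then have "a + y \<le> H" "b + y \<le> H" using True by (auto simp: n_def)
      then show "(\<alpha> + \<beta> + \<eta> - \<tau>) * y \<le> card (E \<inter> {a..<a + y}) + card (F \<inter> {b..<b + y})"
        using a(3)[of y] b(3)[of y] by (simp add: algebra_simps)
    qed (use \<eta> a(1,4) b(1,4) True assms(1-3) in auto)
    moreover have "card (?T \<inter> {..<H}) = card (?T \<inter> {..<a + b}) + card (?T \<inter> {a + b..<a + b + n})"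
      using True card_Int_split[of "a + b" H ?T] by (simp add: n_def)
    ultimately have "(\<alpha> + \<beta> + \<eta> - \<tau>) * n + ((\<alpha> + \<beta> - 2 * \<tau>) * (a + b) - 2 * \<tau> * H) \<le> card (?T \<inter> {..<H})"
      using base[of "a + b"] True by simp
    moreover have "(\<alpha> + \<beta> + \<eta> - \<tau>) * n + (\<alpha> + \<beta> - 2 * \<tau>) * (a + b) =
        (\<alpha> + \<beta> - \<tau>) * H + \<eta> * n - \<tau> * (real a + b)"
      unfolding n by (simp add: algebra_simps)
    moreover have "\<tau> * (real a + b) \<le> \<tau> * H" using True assms(1) by (intro mult_left_mono) auto
    moreover have "\<eta> * n \<ge> \<eta>\<^sup>2 * H - 2 * \<tau> * H"
    proof -
      have "real n \<ge> \<eta> * H - 2 * \<tau> * H" using n room small by linarith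
      then have "\<eta> * n \<ge> \<eta> * (\<eta> * H - 2 * \<tau> * H)" using \<eta> by (intro mult_left_mono) auto
      moreover have "\<eta> * (2 * \<tau> * H) \<le> 1 * (2 * \<tau> * H)" using \<tau>1 H0 by (intro mult_right_mono) auto
      ultimately show ?thesis by (simp add: algebra_simps power2_eq_square)
    qed
    ultimately show ?thesis using H0 by (simp add: algebra_simps)
  qed
qed

section \<open>Thick points of sumsets of integers\<close>

definition block :: "nat \<Rightarrow> nat \<Rightarrow> int set" where
  "block L i = {int (i * L) + 1..int (i * L) + int L}"

definition dense_blocks :: "real \<Rightarrow> nat \<Rightarrow> int set \<Rightarrow> nat set" where
  "dense_blocks \<nu> L X = {i. (1 - \<nu>) * L \<le> card (X \<inter> block L i)}"

definition thick_points :: "nat \<Rightarrow> nat \<Rightarrow> int set \<Rightarrow> int set" where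
  "thick_points n k W = {z \<in> {1..int n}. z +o {- int k..int k} \<subseteq> W}"

lemma finite_thick_points [simp]: "finite (thick_points n k W)"
  by (rule finite_subset[of _ "{1..int n}"]) (auto simp: thick_points_def)

lemma finite_block [simp]: "finite (block L i)"
  by (simp add: block_def)

lemma card_block [simp]: "card (block L i) = L"
  by (simp add: block_def)

lemma block_disjoint:
  assumes "i \<noteq> j"
  shows "block L i \<inter> block L j = {}"
proof -
  have "block L i \<inter> block L j = {}" if "i < j" for i j
  proof -
    have "Suc i * L \<le> j * L" using that by (intro mult_right_mono) auto
    then have "int (i * L) + int L \<le> int (j * L)" unfolding of_nat_add[symmetric] of_nat_le_iff by simp
    then show ?thesis unfolding block_def by auto
  qed
  with assms show ?thesis by (metis Int_commute nat_neq_iff)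
qed

lemma Un_blocks: "(\<Union>i<x. block L i) = {1..int (x * L)}"
proof (induction x)
  case (Suc x)
  have "{1..a + b} = {1..a} \<union> {a + 1..a + b}" if "0 \<le> a" "0 \<le> b" for a b :: int
    using that by auto
  from this[of "int (x * L)" "int L"]
  have "{1..int (Suc x * L)} = {1..int (x * L)} \<union> block L x"
    by (simp add: block_def add.commute)
  then show ?case using Suc by (simp add: lessThan_Suc Un_commute)
qed auto

lemma card_UN_blocks:
  assumes "finite I" "\<And>i. i \<in> I \<Longrightarrow> S i \<subseteq> block L i"
  shows "card (\<Union>i\<in>I. S i) = (\<Sum>i\<in>I. card (S i))"
proof (rule card_UN_disjoint)
  show "\<forall>i\<in>I. finite (S i)" using assms(2) finite_subset[OF _ finite_block] by blast
  show "\<forall>i\<in>I. \<forall>j\<in>I. i \<noteq> j \<longrightarrow> S i \<inter> S j = {}" using assms(2) block_disjoint by blast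
qed (rule assms)

lemma subset_thicken: "X \<subseteq> X + {- int m..int m}" for X :: "int set"
  using set_plus_intro[of _ X 0 "{- int m..int m}"] by auto

text \<open>
  A block of length L meeting X lies in X + [-L, L]. If thickening X by L hardly enlarges it, few
  blocks can meet X without being nearly filled by it.
\<close>

lemma dense_blocks_count:
  fixes X :: "int set" and \<nu> \<epsilon> :: real
  assumes "0 < \<nu>" "x * L \<le> n"
    and thicken: "card ((X + {- int L..int L}) \<inter> {1..int n}) \<le> card (X \<inter> {1..int n}) + \<epsilon> * n"
  shows "card (X \<inter> {1..int (x * L)}) - \<epsilon> / \<nu> * n \<le> L * card (dense_blocks \<nu> L X \<inter> {..<x})"
proof -
  let ?D = "dense_blocks \<nu> L X"
  define N where "N = {i \<in> {..<x}. i \<notin> ?D \<and> X \<inter> block L i \<noteq> {}}"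
  have fin: "finite N" by (simp add: N_def)
  have "card (X \<inter> {1..int (x * L)}) = card (\<Union>i<x. X \<inter> block L i)"
    unfolding Un_blocks[symmetric] by (simp only: Int_UN_distrib)
  also have "\<dots> = (\<Sum>i<x. card (X \<inter> block L i))" by (rule card_UN_blocks) auto
  also have "\<dots> \<le> (\<Sum>i<x. (if i \<in> ?D then L else 0) + (if i \<in> N then L else 0))"
  proof (rule sum_mono)
    fix i assume "i \<in> {..<x}"
    moreover have "card (X \<inter> block L i) \<le> card (block L i)" by (intro card_mono) auto
    ultimately show "card (X \<inter> block L i) \<le> (if i \<in> ?D then L else 0) + (if i \<in> N then L else 0)"
      by (auto simp: N_def)
  qed
  also have "\<dots> = L * card (?D \<inter> {..<x}) + L * card N"
  proof -
    have "(\<Sum>i<x. if i \<in> S then L else 0) = L * card (S \<inter> {..<x})" for S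
      by (simp add: sum.If_cases Int_commute)
    moreover have "N \<inter> {..<x} = N" by (auto simp: N_def)
    ultimately show ?thesis by (simp only: sum.distrib)
  qed
  finally have le: "card (X \<inter> {1..int (x * L)}) \<le> L * card (?D \<inter> {..<x}) + L * card N" .
  \<comment> \<open>A block of N misses more than \<nu> L points, each within L of a point of X in
    the same block. Thickening supplies them all, yet adds at most \<epsilon> n points to
    [1, n].\<close>
  have "card N * (\<nu> * L) = (\<Sum>i\<in>N. \<nu> * L)" by simp
  also have "\<dots> \<le> (\<Sum>i\<in>N. real (card (block L i - X)))"
  proof (rule sum_mono)
    fix i assume "i \<in> N"
    then have "card (X \<inter> block L i) < (1 - \<nu>) * L" by (simp add: N_def dense_blocks_def)
    moreover have "card (block L i) = card (block L i - X) + card (X \<inter> block L i)"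
      using card_Int_Diff[of "block L i" X] by (simp add: Int_commute)
    ultimately show "\<nu> * L \<le> real (card (block L i - X))" by (simp add: algebra_simps)
  qed
  also have "\<dots> = card (\<Union>i\<in>N. block L i - X)"
    using card_UN_blocks[OF fin, of "\<lambda>i. block L i - X" L] by simp
  also have "\<dots> \<le> card ((X + {- int L..int L}) \<inter> {1..int n} - X \<inter> {1..int n})"
  proof (intro of_nat_mono card_mono subsetI)
    fix z assume "z \<in> (\<Union>i\<in>N. block L i - X)"
    then obtain i y where i: "i < x" "z \<in> block L i" "z \<notin> X" "y \<in> X" "y \<in> block L i"
      by (auto simp: N_def)
    have "y + (z - y) \<in> X + {- int L..int L}" using i by (intro set_plus_intro) (auto simp: block_def)
    moreover have "z \<in> {1..int (x * L)}" using i Un_blocks[of L x] by blast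
    moreover have "int (x * L) \<le> int n" using assms(2) by (simp only: of_nat_le_iff)
    ultimately show "z \<in> (X + {- int L..int L}) \<inter> {1..int n} - X \<inter> {1..int n}" using i by auto
  qed auto
  also have "\<dots> = real (card ((X + {- int L..int L}) \<inter> {1..int n})) - card (X \<inter> {1..int n})"
    using subset_thicken[of X L] by (subst card_Diff_subset) (auto intro!: of_nat_diff card_mono)
  finally have "card N * (\<nu> * L) \<le> \<epsilon> * n" using thicken by linarith
  then have "L * card N \<le> \<epsilon> / \<nu> * n" using assms(1) by (simp add: field_simps)
  moreover have "real (card (X \<inter> {1..int (x * L)})) \<le> real (L * card (?D \<inter> {..<x}) + L * card N)"
    using le by (intro of_nat_mono)
  ultimately show ?thesis by simp
qed

text \<open>Pigeonhole: if z were not a sum, X in block i and z minus Y in block j would be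
  disjoint, with at least 2 (1 - \<nu>) L elements together. They share an interval of 2 L - w + 1
  points for d = 0 and of L + w - 1 points for d = 1, too few when w is away from the start or the
  end of the block, respectively.\<close>

lemma dense_blocks_sum:
  fixes X Y :: "int set" and w :: int and \<nu> :: real
  assumes "i \<in> dense_blocks \<nu> L X" "j \<in> dense_blocks \<nu> L Y" "d \<in> {0, 1}"
    and w: "2 * \<nu> * L + 1 < w" "w < real L + 1 - 2 * \<nu> * L" "1 \<le> w" "w \<le> int L"
  shows "int ((i + j + d) * L) + w \<in> X + Y"
proof (rule ccontr)
  let ?z = "int ((i + j + d) * L) + w"
  let ?P = "X \<inter> block L i" and ?Q = "(\<lambda>y. ?z - y) ` (Y \<inter> block L j)"
  assume "?z \<notin> X + Y"
  then have "?P \<inter> ?Q = {}" using set_plus_intro[of _ X _ Y] by fastforce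
  then have "card (?P \<union> ?Q) = card ?P + card ?Q" by (intro card_Un_disjoint) auto
  moreover have "card ?Q = card (Y \<inter> block L j)" by (intro card_image) (auto simp: inj_on_def)
  ultimately have big: "2 * (1 - \<nu>) * L \<le> card (?P \<union> ?Q)"
    using assms(1,2) by (simp add: dense_blocks_def algebra_simps)
  show False
  proof (cases "d = 0")
    case True
    have "?P \<union> ?Q \<subseteq> {int (i * L) + w - int L..int (i * L) + int L}"
      using True w by (auto simp: block_def algebra_simps)
    then have "card (?P \<union> ?Q) \<le> card {int (i * L) + w - int L..int (i * L) + int L}"
      by (intro card_mono) auto
    then have "real (card (?P \<union> ?Q)) \<le> 2 * real L - w + 1" using w by simp
    with big w show False by (simp add: algebra_simps)
  next
    case False
    then have d: "d = 1" using assms(3) by simp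
    have "?P \<union> ?Q \<subseteq> {int (i * L) + 1..int (i * L) + int L + w - 1}"
      using d w by (auto simp: block_def algebra_simps)
    then have "card (?P \<union> ?Q) \<le> card {int (i * L) + 1..int (i * L) + int L + w - 1}"
      by (intro card_mono) auto
    then have "real (card (?P \<union> ?Q)) \<le> real L + w - 1" using w by simp
    with big w show False by (simp add: algebra_simps)
  qed
qed

lemma thick_points_ge_blocks:
  fixes X Y :: "int set" and \<nu> :: real
  assumes "0 < \<nu>" "H * L \<le> n" "2 * k + 6 \<le> \<nu> * L"
  shows "card ((dense_blocks \<nu> L X + dense_blocks \<nu> L Y + {0, 1}) \<inter> {..<H}) * (L * (1 - 5 * \<nu>))
    \<le> card (thick_points n k (X + Y))"
proof -
  let ?T = "(dense_blocks \<nu> L X + dense_blocks \<nu> L Y + {0, 1}) \<inter> {..<H}"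
  \<comment> \<open>The margin r covers the ends excluded in \<open>dense_blocks_sum\<close> and the
    shifts by up to k. Both margins together take at most 5 \<nu> L points, thanks to 2 k + 6 \<le>
    \<nu> L.\<close>
  define r where "r = nat \<lceil>2 * \<nu> * L\<rceil> + 2 + k"
  have r: "2 * \<nu> * L + 2 + k \<le> r" "r \<le> 2 * \<nu> * L + 3 + k"
    unfolding r_def using assms(1) by (auto, linarith+)
  let ?W = "\<lambda>c. {int (c * L) + int r..int (c * L) + int L - int r}"
  have k: "k + 2 \<le> r" by (simp add: r_def)
  then have W: "?W c \<subseteq> block L c" for c by (auto simp: block_def)
  have "card ?T * (L * (1 - 5 * \<nu>)) = (\<Sum>c\<in>?T. L * (1 - 5 * \<nu>))" by simp
  also have "\<dots> \<le> (\<Sum>c\<in>?T. real (card (?W c)))"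
  proof (rule sum_mono)
    fix c
    have "L * (1 - 5 * \<nu>) \<le> real L - 2 * r + 1" using r assms(3) by (simp add: algebra_simps)
    also have "\<dots> = real_of_int (int (c * L) + int L - int r - (int (c * L) + int r) + 1)" by simp
    also have "\<dots> \<le> real (card (?W c))" by simp
    finally show "L * (1 - 5 * \<nu>) \<le> real (card (?W c))" .
  qed
  also have "\<dots> = card (\<Union>c\<in>?T. ?W c)"
    using card_UN_blocks[of ?T ?W L] W by simp
  also have "\<dots> \<le> card (thick_points n k (X + Y))"
  proof (intro of_nat_mono card_mono subsetI)
    fix z assume "z \<in> (\<Union>c\<in>?T. ?W c)"
    then obtain c where c: "c \<in> ?T" "z \<in> ?W c" by blast
    then obtain i j d where ijd: "c = i + j + d" "i \<in> dense_blocks \<nu> L X" "j \<in> dense_blocks \<nu> L Y" "d \<in> {0, 1}"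
      by (elim IntE set_plus_elim) auto
    have "z \<in> {1..int (H * L)}"
      using c W[of c] Un_blocks[of L H] by blast
    moreover have "int (H * L) \<le> int n" using assms(2) by (simp only: of_nat_le_iff)
    moreover have "z + t \<in> X + Y" if t: "t \<in> {- int k..int k}" for t
    proof -
      define w where "w = z + t - int (c * L)"
      have w: "int r - int k \<le> w" "w \<le> int L - int r + int k" using c t by (auto simp: w_def)
      have "int ((i + j + d) * L) + w \<in> X + Y"
      proof (rule dense_blocks_sum[OF ijd(2-4)])
        show "2 * \<nu> * L + 1 < w" using w(1) r(1) by linarith
        show "w < real L + 1 - 2 * \<nu> * L" using w(2) r(1) by linarith
      qed (use w k in auto)
      then show ?thesis using ijd(1) by (simp add: w_def)
    qed
    ultimately show "z \<in> thick_points n k (X + Y)"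
      by (auto simp: thick_points_def elt_set_plus_def)
  qed simp
  finally show ?thesis .
qed

section \<open>From counts of integers to counts of blocks\<close>

text \<open>Blocks that are not dense cost (\<epsilon> / \<tau>) n, the density hypothesis
  \<epsilon> n. By 4 \<epsilon> = \<open>\<tau> ^ 3\<close> each is at most a quarter of
  \<open>\<tau>\<^sup>2 * n\<close>, and n \<le> 2 H L turns the sum into
  \<open>\<tau>\<^sup>2 * H\<close> blocks.\<close>

lemma dense_blocks_density:
  fixes X :: "int set" and a \<epsilon> \<tau> :: real and H :: nat
  assumes "0 < \<tau>" "\<tau> \<le> 1" "0 < L" and \<epsilon>: "4 * \<epsilon> = \<tau> ^ 3"
    and "x * L \<le> n" "n \<le> 2 * (H * L)"
    and "card ((X + {- int L..int L}) \<inter> {1..int n}) \<le> card (X \<inter> {1..int n}) + \<epsilon> * n"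
    and dens: "a * (x * L) - \<epsilon> * n \<le> card (X \<inter> {1..int (x * L)})"
  shows "a * x - \<tau>\<^sup>2 * H \<le> card (dense_blocks \<tau> L X \<inter> {..<x})"
proof -
  have \<epsilon>\<tau>: "\<epsilon> / \<tau> = \<tau>\<^sup>2 / 4" using \<epsilon> assms(1) by (simp add: field_simps power2_eq_square power3_eq_cube)
  have "\<epsilon> \<le> \<tau>\<^sup>2 / 4"
    using \<epsilon> assms(1,2) power_decreasing[of 2 3 \<tau>] by simp
  then have "\<epsilon> * n \<le> \<tau>\<^sup>2 / 4 * n" by (intro mult_right_mono) auto
  moreover have "\<tau>\<^sup>2 / 4 * n \<le> \<tau>\<^sup>2 / 4 * real (2 * (H * L))"
    using assms(6) by (intro mult_left_mono) (simp_all only: of_nat_le_iff, simp)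
  moreover have "card (X \<inter> {1..int (x * L)}) - \<tau>\<^sup>2 / 4 * n \<le> L * card (dense_blocks \<tau> L X \<inter> {..<x})"
    using dense_blocks_count[OF assms(1,5,7)] unfolding \<epsilon>\<tau> .
  ultimately have "a * (x * L) - \<tau>\<^sup>2 * (H * L) \<le> L * card (dense_blocks \<tau> L X \<inter> {..<x})"
    using dens by (simp add: algebra_simps)
  then have "L * (a * x - \<tau>\<^sup>2 * H) \<le> L * real (card (dense_blocks \<tau> L X \<inter> {..<x}))"
    by (simp add: algebra_simps)
  then show ?thesis using assms(3) by simp
qed

text \<open>The 14 \<tau> are made up of 8 \<tau> from counting blocks, \<tau> from the points
  behind the last block and 5 \<tau> from the margins inside blocks.\<close>

lemma thick_points_of_block_density:
  fixes X Y :: "int set" and c \<tau> :: real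
  assumes "0 < \<tau>" "c \<le> 1" "2 * k + 6 \<le> \<tau> * L" "H * L \<le> n" "(1 - \<tau>) * n \<le> real (H * L)"
    and T: "(c - 8 * \<tau>) * H \<le> card ((dense_blocks \<tau> L X + dense_blocks \<tau> L Y + {0, 1}) \<inter> {..<H})"
  shows "(c - 14 * \<tau>) * n \<le> card (thick_points n k (X + Y))"
proof (cases "c - 14 * \<tau> \<le> 0")
  case True
  then have "(c - 14 * \<tau>) * n \<le> 0" by (intro mult_nonpos_nonneg) auto
  then show ?thesis by linarith
next
  case False
  define d where "d = c - 8 * \<tau>"
  have d: "0 \<le> d" "d \<le> 1" "5 * \<tau> \<le> 1" "d * \<tau> \<le> \<tau>"
    using False assms(1,2) mult_right_mono[of d 1 \<tau>] by (auto simp: d_def)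
  have "c - 14 * \<tau> \<le> d - 6 * (d * \<tau>)" using d by (simp add: d_def)
  also have "\<dots> \<le> d * (1 - \<tau>) * (1 - 5 * \<tau>)" using d assms(1) by (simp add: algebra_simps)
  finally have "(c - 14 * \<tau>) * n \<le> d * (1 - \<tau>) * (1 - 5 * \<tau>) * n" by (intro mult_right_mono) auto
  also have "\<dots> = d * (1 - 5 * \<tau>) * ((1 - \<tau>) * n)" by simp
  also have "\<dots> \<le> d * (1 - 5 * \<tau>) * real (H * L)" using d assms(5) by (intro mult_left_mono) auto
  also have "\<dots> = d * H * (L * (1 - 5 * \<tau>))" by simp
  also have "\<dots> \<le> card ((dense_blocks \<tau> L X + dense_blocks \<tau> L Y + {0, 1}) \<inter> {..<H}) * (L * (1 - 5 * \<tau>))"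
    using T d by (intro mult_right_mono) (auto simp: d_def)
  also have "\<dots> \<le> card (thick_points n k (X + Y))"
    by (rule thick_points_ge_blocks[OF assms(1,4,3)])
  finally show ?thesis .
qed

text \<open>[1, n] is cut into n div L blocks, and k enters only through L. The second conclusion
  lets a surplus 2 \<eta> of X on [1, n] pay for the error once 14 \<tau> \<le>
  \<open>\<eta>\<^sup>2\<close>.\<close>

lemma sumset_thick_points:
  fixes X Y :: "int set" and \<alpha> \<beta> \<tau> \<epsilon> :: real
  assumes \<tau>: "0 < \<tau>" "\<tau> \<le> 1" "\<tau> < \<alpha>" "\<tau> < \<beta>" and \<epsilon>: "4 * \<epsilon> = \<tau> ^ 3"
    and L: "2 * k + 6 \<le> \<tau> * L" "L \<le> \<epsilon> * n"
    and X: "\<And>x. x \<le> n \<Longrightarrow> \<alpha> * x - \<epsilon> * n \<le> card (X \<inter> {1..int x})"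
      "card ((X + {- int L..int L}) \<inter> {1..int n}) \<le> card (X \<inter> {1..int n}) + \<epsilon> * n"
    and Y: "\<And>x. x \<le> n \<Longrightarrow> \<beta> * x - \<epsilon> * n \<le> card (Y \<inter> {1..int x})"
      "card ((Y + {- int L..int L}) \<inter> {1..int n}) \<le> card (Y \<inter> {1..int n}) + \<epsilon> * n"
  shows "(min (\<alpha> + \<beta>) 1 - 14 * \<tau>) * n \<le> card (thick_points n k (X + Y))"
    and "\<lbrakk>0 < \<eta>; \<alpha> + \<beta> + \<eta> \<le> 1; (\<alpha> + 2 * \<eta>) * n \<le> card (X \<inter> {1..int n})\<rbrakk> \<Longrightarrow>
      (\<alpha> + \<beta> + \<eta>\<^sup>2 - 14 * \<tau>) * n \<le> card (thick_points n k (X + Y))"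
proof -
  define H where "H = n div L"
  have "0 < \<tau> * L" using L(1) by linarith
  then have L0: "0 < L" using \<tau>(1) by (simp add: zero_less_mult_iff)
  have HL: "H * L \<le> n" "n < H * L + L"
    unfolding H_def using dividend_less_div_times[OF L0, of n] by (simp_all add: add.commute)
  have "\<tau> ^ 3 \<le> \<tau> ^ 1" using \<tau> by (intro power_decreasing) auto
  then have "4 * \<epsilon> \<le> \<tau>" using \<epsilon> by simp
  then have "4 * \<epsilon> * n \<le> \<tau> * n" "\<tau> * n \<le> 1 * real n" using \<tau> by (intro mult_right_mono; simp)+
  moreover have HLr: "real n < real (H * L) + L" using HL(2) unfolding of_nat_add[symmetric] of_nat_less_iff .
  ultimately have big: "(1 - \<tau>) * n \<le> real (H * L)" "n \<le> 2 * (H * L)"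
    using L(2) by (auto simp: left_diff_distrib, linarith+)
  have le: "x * L \<le> n" if "x \<le> H" for x
    using HL(1) mult_le_mono1[OF that, of L] by linarith
  have EX: "\<alpha> * x - \<tau>\<^sup>2 * H \<le> card (dense_blocks \<tau> L X \<inter> {..<x})" if "x \<le> H" for x
    using dense_blocks_density[OF \<tau>(1,2) L0 \<epsilon> le[OF that] big(2) X(2)] X(1)[OF le[OF that]] by simp
  have EY: "\<beta> * x - \<tau>\<^sup>2 * H \<le> card (dense_blocks \<tau> L Y \<inter> {..<x})" if "x \<le> H" for x
    using dense_blocks_density[OF \<tau>(1,2) L0 \<epsilon> le[OF that] big(2) Y(2)] Y(1)[OF le[OF that]] by simp
  have "\<tau> * H \<ge> 0" using \<tau> by simp
  then have "(min (\<alpha> + \<beta>) 1 - 8 * \<tau>) * H \<le>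
      card ((dense_blocks \<tau> L X + dense_blocks \<tau> L Y + {0, 1}) \<inter> {..<H})"
    using block_sumset_count[OF \<tau>(1,3,4) EX EY order_refl] by (simp add: left_diff_distrib)
  then show "(min (\<alpha> + \<beta>) 1 - 14 * \<tau>) * n \<le> card (thick_points n k (X + Y))"
    by (intro thick_points_of_block_density[OF \<tau>(1) _ L(1) HL(1) big(1)]) auto
  assume \<eta>: "0 < \<eta>" "\<alpha> + \<beta> + \<eta> \<le> 1" and gain: "(\<alpha> + 2 * \<eta>) * n \<le> card (X \<inter> {1..int n})"
  \<comment> \<open>At most L \<le> \<epsilon> n elements of X lie beyond the last complete block,
    so the surplus survives on [1, H L].\<close>
  have "card (X \<inter> {1..int n}) \<le> card (X \<inter> {1..int (H * L)} \<union> {int (H * L) + 1..int n})"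
    by (intro card_mono) auto
  also have "\<dots> \<le> card (X \<inter> {1..int (H * L)}) + card {int (H * L) + 1..int n}"
    by (rule card_Un_le)
  finally have "card (X \<inter> {1..int n}) \<le> card (X \<inter> {1..int (H * L)}) + card {int (H * L) + 1..int n}" .
  moreover have "card {int a + 1..int b} = b - a" for a b by auto
  from this[of "H * L" n] have "card {int (H * L) + 1..int n} \<le> L" using HL(2) by linarith
  ultimately have "real (card (X \<inter> {1..int n})) \<le> card (X \<inter> {1..int (H * L)}) + L" by linarith
  moreover have "real (H * L) \<le> real n" using HL(1) by (simp only: of_nat_le_iff)
  then have "(\<alpha> + 2 * \<eta>) * (H * L) \<le> (\<alpha> + 2 * \<eta>) * n"
    using \<tau> \<eta> by (intro mult_left_mono) auto
  ultimately have "(\<alpha> + 2 * \<eta>) * (H * L) - \<epsilon> * n \<le> card (X \<inter> {1..int (H * L)})"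
    using gain L(2) by linarith
  then have "(\<alpha> + 2 * \<eta>) * H - \<tau>\<^sup>2 * H \<le> card (dense_blocks \<tau> L X \<inter> {..<H})"
    using dense_blocks_density[OF \<tau>(1,2) L0 \<epsilon> HL(1) big(2) X(2), of "\<alpha> + 2 * \<eta>"] by simp
  from block_sumset_count_gain[OF \<tau>(1,3,4) EX EY \<eta> this]
  have "(\<alpha> + \<beta> + \<eta>\<^sup>2 - 8 * \<tau>) * H \<le>
      card ((dense_blocks \<tau> L X + dense_blocks \<tau> L Y + {0, 1}) \<inter> {..<H})" .
  moreover have "\<eta> * \<eta> \<le> \<eta> * 1" using \<eta> \<tau> by (intro mult_left_mono) linarith+
  then have "\<alpha> + \<beta> + \<eta>\<^sup>2 \<le> 1" using \<eta> unfolding power2_eq_square by linarith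
  ultimately show "(\<alpha> + \<beta> + \<eta>\<^sup>2 - 14 * \<tau>) * n \<le> card (thick_points n k (X + Y))"
    by (intro thick_points_of_block_density[OF \<tau>(1) _ L(1) HL(1) big(1)])
qed

section \<open>Sets of positive lower density\<close>

text \<open>The lower limit gives slope \<alpha> - \<epsilon> for x \<ge> n1; for smaller x the main
  term is at most \<alpha> n1, which \<epsilon> n absorbs once n is large.\<close>

lemma lower_density_count:
  fixes \<alpha> \<epsilon> :: real
  assumes "lower_density A = ereal \<alpha>" "0 \<le> \<alpha>" "0 < \<epsilon>"
  obtains n0 where "\<And>n x :: nat. n0 \<le> n \<Longrightarrow> x \<le> n \<Longrightarrow> \<alpha> * x - \<epsilon> * n \<le> card (A \<inter> {1..int x})"
proof -
  have "\<forall>y<ereal \<alpha>. \<forall>\<^sub>F n in sequentially. y < ereal (real (card (A \<inter> {1..int n})) / real n)"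
    using assms(1) unfolding lower_density_def by (simp only: le_Liminf_iff[symmetric])
  from this[rule_format, of "ereal (\<alpha> - \<epsilon>)"] assms(3)
  have "\<forall>\<^sub>F n in sequentially. \<alpha> - \<epsilon> < real (card (A \<inter> {1..int n})) / real n" by simp
  then obtain n1 where n1: "\<And>n. n1 \<le> n \<Longrightarrow> \<alpha> - \<epsilon> < real (card (A \<inter> {1..int n})) / real n"
    by (auto simp: eventually_sequentially)
  show thesis
  proof (rule that[of "nat \<lceil>\<alpha> * n1 / \<epsilon>\<rceil>"])
    fix n x :: nat assume n: "nat \<lceil>\<alpha> * n1 / \<epsilon>\<rceil> \<le> n" and "x \<le> n"
    show "\<alpha> * x - \<epsilon> * n \<le> card (A \<inter> {1..int x})"
    proof (cases "n1 \<le> x \<and> x \<noteq> 0")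
      case True
      then have "(\<alpha> - \<epsilon>) * x < card (A \<inter> {1..int x})" using n1[of x] by (simp add: field_simps)
      moreover have "\<epsilon> * x \<le> \<epsilon> * n" using \<open>x \<le> n\<close> assms(3) by (intro mult_left_mono) auto
      ultimately show ?thesis by (simp add: left_diff_distrib)
    next
      case False
      then have "\<alpha> * x \<le> \<alpha> * n1" using assms(2) by (intro mult_left_mono) auto
      moreover have "\<alpha> * n1 / \<epsilon> \<le> n" using n by linarith
      then have "\<alpha> * n1 \<le> \<epsilon> * n" using assms(3) by (simp add: field_simps)
      ultimately show ?thesis by linarith
    qed
  qed
qed

text \<open>A limit superior below \<gamma> would keep the ratio below some r < \<gamma> at all
  large n in S, against the hypothesis with \<delta> = \<gamma> - r.\<close>

lemma Limsup_thick_points_ge: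
  assumes "\<And>\<delta> n0. 0 < \<delta> \<Longrightarrow> \<exists>n\<ge>n0. n \<in> S \<and> (\<gamma> - \<delta>) * real n \<le> card (thick_points n k W)"
  shows "ereal \<gamma> \<le> Limsup (inf sequentially (principal S))
    (\<lambda>n. ereal (1 / real n * real (card (thick_points n k W))))"
proof (rule ccontr)
  assume "\<not> ?thesis"
  then obtain r where r: "Limsup (inf sequentially (principal S))
      (\<lambda>n. ereal (1 / real n * real (card (thick_points n k W)))) < ereal r" "r < \<gamma>"
    using ereal_dense2 by (force simp: not_le)
  from Limsup_lessD[OF r(1)] obtain N where
    N: "\<And>n. N \<le> n \<Longrightarrow> n \<in> S \<Longrightarrow> 1 / real n * real (card (thick_points n k W)) < r"
    unfolding eventually_inf_principal eventually_sequentially by auto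
  obtain n where n: "max N 1 \<le> n" "n \<in> S" "(\<gamma> - (\<gamma> - r)) * real n \<le> card (thick_points n k W)"
    using assms[of "\<gamma> - r" "max N 1"] r(2) by auto
  then have "r \<le> 1 / real n * real (card (thick_points n k W))" by (simp add: field_simps)
  with N[of n] n show False by simp
qed

lemma interval_plus_interval: "{- int m..int m} + {- int l..int l} = {- int (m + l)..int (m + l)}"
proof (intro equalityI subsetI)
  fix z assume z: "z \<in> {- int (m + l)..int (m + l)}"
  \<comment> \<open>z is clamped to [-m, m]; the remainder then lies in [-l, l].\<close>
  define x where "x = max (- int m) (min (int m) z)"
  have "x + (z - x) \<in> {- int m..int m} + {- int l..int l}"
    using z by (intro set_plus_intro) (auto simp: x_def)
  then show "z \<in> {- int m..int m} + {- int l..int l}" by simp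
qed (auto elim!: set_plus_elim)

section \<open>Densities with sum below 1\<close>

text \<open>The radius must be fixed before k and \<delta>. If \<open>\<Phi>\<close> exceeds
  \<alpha> + \<beta>, a radius that almost attains it makes further thickening cheap and yields a
  gain that cancels the error; otherwise A and B themselves hardly grow, and the error may depend on
  \<delta>.\<close>

lemma sumset_upper_syndetic:
  fixes A B :: "int set" and \<alpha> \<beta> :: real
  assumes A: "lower_density A = ereal \<alpha>" "0 < \<alpha>" and B: "lower_density B = ereal \<beta>" "0 < \<beta>"
    and "\<alpha> + \<beta> < 1" and S: "infinite (S :: nat set)"
  shows "\<exists>m. \<forall>k \<delta> n0. 0 < \<delta> \<longrightarrow> (\<exists>n\<ge>n0. n \<in> S \<and>
    (\<alpha> + \<beta> - \<delta>) * real n \<le> card (thick_points n k (A + B + {- int m..int m})))"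
proof -
  define cA cB where "cA m n = card ((A + {- int m..int m}) \<inter> {1..int n})"
    and "cB m n = card ((B + {- int m..int m}) \<inter> {1..int n})" for m n :: nat
  have thickA: "A + {- int m..int m} + {- int l..int l} = A + {- int (m + l)..int (m + l)}"
    and thickB: "B + {- int m..int m} + {- int l..int l} = B + {- int (m + l)..int (m + l)}"
    and thickAB: "A + {- int m..int m} + (B + {- int m..int m}) = A + B + {- int (m + m)..int (m + m)}" for m l
    by (simp_all only: interval_plus_interval[symmetric] ac_simps)
  have cA_mono: "cA m n \<le> cA (m + l) n" and cB_mono: "cB m n \<le> cB (m + l) n" for m l n
    unfolding cA_def cB_def thickA[symmetric] thickB[symmetric]
    using subset_thicken by (auto intro!: card_mono)
  have c_le: "cA m n \<le> n" "cB m n \<le> n" for m n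
    unfolding cA_def cB_def using card_mono[of "{1..int n}" "_ \<inter> {1..int n}"] by auto
  have c0: "card (A \<inter> {1..int n}) \<le> cA m n" "card (B \<inter> {1..int n}) \<le> cB m n" for m n
    unfolding cA_def cB_def using subset_thicken by (auto intro!: card_mono)
  \<comment> \<open>\<open>\<Phi>\<close> is the supremum over m of the upper densities along S of the thickened sets, added up.\<close>
  define R where "R = {s. \<exists>m. \<forall>n0. \<exists>n\<ge>n0. n \<in> S \<and> s * real n \<le> real (cA m n + cB m n)}"
  define \<Phi> where "\<Phi> = Sup R"
  have R0: "0 \<in> R" using S by (auto simp: R_def infinite_nat_iff_unbounded_le)
  have bdd: "bdd_above R"
  proof (rule bdd_aboveI)
    fix s assume "s \<in> R"
    then obtain m n where n: "1 \<le> n" "s * real n \<le> real (cA m n + cB m n)" unfolding R_def by blast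
    then have "s * real n \<le> 2 * real n" using c_le[of m n] by linarith
    then show "s \<le> 2" using n by simp
  qed
  have often: "\<exists>m. \<forall>n0. \<exists>n\<ge>n0. n \<in> S \<and> (\<Phi> - e) * real n \<le> real (cA m n + cB m n)" if "0 < e" for e
  proof -
    have "\<Phi> - e < Sup R" using that by (simp add: \<Phi>_def)
    then obtain s where s: "s \<in> R" "\<Phi> - e < s" using R0 less_cSup_iff[OF _ bdd] by blast
    then have "(\<Phi> - e) * real n \<le> s * real n" for n by (intro mult_right_mono) auto
    with s(1) show ?thesis unfolding R_def by (blast intro: order_trans)
  qed
  \<comment> \<open>Together with \<open>often\<close>: enlarging the m found there by any L adds
    less than 2 e n to the sum of the counts at infinitely many n in S.\<close>
  have finally_small: "\<exists>n0. \<forall>n\<ge>n0. n \<in> S \<longrightarrow> real (cA m n + cB m n) < (\<Phi> + e) * real n" if "0 < e" for m e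
  proof (rule ccontr)
    assume "\<not> ?thesis"
    then have "\<Phi> + e \<in> R" unfolding R_def by (auto simp: not_less)
    then have "\<Phi> + e \<le> \<Phi>" unfolding \<Phi>_def by (intro cSup_upper bdd)
    with that show False by simp
  qed
  have length: "\<exists>L. 2 * real k + 6 \<le> \<tau> * real L" if "0 < \<tau>" for \<tau> k
    using real_arch_simple[of "(2 * real k + 6) / \<tau>"] that by (auto simp: field_simps)
  show ?thesis
  proof (cases "\<alpha> + \<beta> < \<Phi>")
    case True
    \<comment> \<open>Of 5 \<eta>, at least 4 \<eta> remain after subtracting e \<le> \<eta>, so one
      of the two sets has surplus 2 \<eta>. The second entry keeps the raised slope at most
      1.\<close>
    define \<eta> where "\<eta> = min ((\<Phi> - (\<alpha> + \<beta>)) / 5) (1 - (\<alpha> + \<beta>))"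
    have "\<eta> \<le> (\<Phi> - (\<alpha> + \<beta>)) / 5" "\<eta> \<le> 1 - (\<alpha> + \<beta>)"
      unfolding \<eta>_def by (rule min.cobounded1 min.cobounded2)+
    moreover have "0 < \<eta>" using True assms(5) by (simp add: \<eta>_def)
    ultimately have \<eta>: "0 < \<eta>" "\<alpha> + \<beta> + 5 * \<eta> \<le> \<Phi>" "\<alpha> + \<beta> + \<eta> \<le> 1" by simp_all
    \<comment> \<open>The last entry makes the gain \<open>\<eta>\<^sup>2\<close> cover the error 14
      \<tau>, so that \<alpha> + \<beta> is reached without loss.\<close>
    define \<tau> where "\<tau> = Min {\<alpha> / 2, \<beta> / 2, 1, \<eta>\<^sup>2 / 14}"
    have \<tau>: "0 < \<tau>" "\<tau> \<le> 1" "\<tau> < \<alpha>" "\<tau> < \<beta>" "14 * \<tau> \<le> \<eta>\<^sup>2"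
      using A(2) B(2) \<eta> by (auto simp: \<tau>_def min_def)
    define \<epsilon> where "\<epsilon> = \<tau> ^ 3 / 4"
    have \<epsilon>: "4 * \<epsilon> = \<tau> ^ 3" "0 < \<epsilon>" using \<tau> by (auto simp: \<epsilon>_def)
    \<comment> \<open>Both counts can only grow with the radius, so each grows by at most the joint
      growth 2 e n \<le> \<epsilon> n.\<close>
    define e where "e = min (\<epsilon> / 2) \<eta>"
    have e: "0 < e" "2 * e \<le> \<epsilon>" "e \<le> \<eta>" using \<epsilon> \<eta> by (auto simp: e_def min_def)
    \<comment> \<open>This m is chosen from e before k and \<delta> are given; only L depends on k.
      The final radius is m + m.\<close>
    obtain m where m: "\<And>n0. \<exists>n\<ge>n0. n \<in> S \<and> (\<Phi> - e) * real n \<le> real (cA m n + cB m n)"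
      using often[OF e(1)] by blast
    obtain nA where nA: "\<And>n x :: nat. nA \<le> n \<Longrightarrow> x \<le> n \<Longrightarrow> \<alpha> * x - \<epsilon> * n \<le> card (A \<inter> {1..int x})"
      using lower_density_count[OF A(1) less_imp_le[OF A(2)] \<epsilon>(2)] by blast
    obtain nB where nB: "\<And>n x :: nat. nB \<le> n \<Longrightarrow> x \<le> n \<Longrightarrow> \<beta> * x - \<epsilon> * n \<le> card (B \<inter> {1..int x})"
      using lower_density_count[OF B(1) less_imp_le[OF B(2)] \<epsilon>(2)] by blast
    have "\<exists>n\<ge>n0. n \<in> S \<and>
        (\<alpha> + \<beta> - \<delta>) * real n \<le> card (thick_points n k (A + B + {- int (m + m)..int (m + m)}))"
      if "0 < \<delta>" for k \<delta> n0
    proof -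
      obtain L where L: "2 * real k + 6 \<le> \<tau> * real L" using length[OF \<tau>(1)] by blast
      obtain n1 where n1: "\<And>n. n1 \<le> n \<Longrightarrow> n \<in> S \<Longrightarrow> real (cA (m + L) n + cB (m + L) n) < (\<Phi> + e) * real n"
        using finally_small[OF e(1), of "m + L"] by blast
      obtain n where n: "max (max n0 n1) (max (max nA nB) (nat \<lceil>L / \<epsilon>\<rceil>)) \<le> n" "n \<in> S"
          "(\<Phi> - e) * real n \<le> real (cA m n + cB m n)"
        using m by blast
      have "L / \<epsilon> \<le> n" using n(1) by linarith
      then have Ln: "L \<le> \<epsilon> * n" using \<epsilon>(2) by (simp add: field_simps)
      have up: "real (cA (m + L) n + cB (m + L) n) < (\<Phi> + e) * real n" using n by (intro n1) auto
      have en: "2 * (e * n) \<le> \<epsilon> * n" using mult_right_mono[OF e(2), of "real n"] by simp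
      have mono: "cA m n \<le> cA (m + L) n" "cB m n \<le> cB (m + L) n" by (rule cA_mono cB_mono)+
      have fat: "cA (m + L) n \<le> cA m n + \<epsilon> * n" "cB (m + L) n \<le> cB m n + \<epsilon> * n"
        using up n(3) en mono unfolding left_diff_distrib distrib_right of_nat_add by linarith+
      have low: "\<alpha> * x - \<epsilon> * n \<le> cA m x" "\<beta> * x - \<epsilon> * n \<le> cB m x" if "x \<le> n" for x
        using nA[of n x] nB[of n x] that n(1) c0(1)[of x m] c0(2)[of x m] by (auto intro: order_trans)
      have "(\<alpha> + 2 * \<eta>) * n \<le> cA m n \<or> (\<beta> + 2 * \<eta>) * n \<le> cB m n"
      proof (rule ccontr)
        assume "\<not> ?thesis"
        then have "real (cA m n + cB m n) < (\<alpha> + 2 * \<eta>) * n + (\<beta> + 2 * \<eta>) * n" by simp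
        also have "\<dots> = (\<alpha> + \<beta> + 4 * \<eta>) * n" by (simp add: algebra_simps)
        also have "\<dots> \<le> (\<Phi> - e) * n" using \<eta> e by (intro mult_right_mono) auto
        finally show False using n(3) by simp
      qed
      then have "(\<alpha> + \<beta> + \<eta>\<^sup>2 - 14 * \<tau>) * real n \<le> card (thick_points n k (A + B + {- int (m + m)..int (m + m)}))"
      proof
        assume gain: "(\<alpha> + 2 * \<eta>) * n \<le> cA m n"
        show ?thesis unfolding thickAB[symmetric]
          by (rule sumset_thick_points(2)[OF \<tau>(1-4) \<epsilon>(1) L Ln _ _ _ _ \<eta>(1,3)])
            (use low fat gain in \<open>simp_all only: cA_def cB_def thickA thickB\<close>)
      next
        assume gain: "(\<beta> + 2 * \<eta>) * n \<le> cB m n"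
        show ?thesis unfolding thickAB[symmetric]
            add.commute[of "A + {- int m..int m}"] add.commute[of \<alpha>]
          by (rule sumset_thick_points(2)[OF \<tau>(1,2,4,3) \<epsilon>(1) L Ln _ _ _ _ \<eta>(1)])
            (use low fat gain \<eta>(3) in \<open>simp_all only: cA_def cB_def thickA thickB add.commute[of \<alpha>]\<close>)
      qed
      moreover have "(\<alpha> + \<beta> - \<delta>) * n \<le> (\<alpha> + \<beta> + \<eta>\<^sup>2 - 14 * \<tau>) * n"
        using \<tau>(5) that by (intro mult_right_mono) auto
      ultimately show ?thesis using n by (intro exI[of _ n]) auto
    qed
    then show ?thesis by blast
  next
    case False
    have "\<exists>n\<ge>n0. n \<in> S \<and> (\<alpha> + \<beta> - \<delta>) * real n \<le> card (thick_points n k (A + B + {- int 0..int 0}))"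
      if "0 < \<delta>" for k \<delta> n0
    proof -
      \<comment> \<open>With radius 0 fixed in advance, \<tau> and the constants derived from it may
        depend on \<delta>.\<close>
      define \<tau> where "\<tau> = Min {\<alpha> / 2, \<beta> / 2, 1, \<delta> / 14}"
      have \<tau>: "0 < \<tau>" "\<tau> \<le> 1" "\<tau> < \<alpha>" "\<tau> < \<beta>" "14 * \<tau> \<le> \<delta>"
        using A(2) B(2) that by (auto simp: \<tau>_def min_def)
      define \<epsilon> where "\<epsilon> = \<tau> ^ 3 / 4"
      have \<epsilon>: "4 * \<epsilon> = \<tau> ^ 3" "0 < \<epsilon>" using \<tau> by (auto simp: \<epsilon>_def)
      then have e: "0 < \<epsilon> / 3" by simp
      obtain L where L: "2 * real k + 6 \<le> \<tau> * real L" using length[OF \<tau>(1)] by blast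
      obtain nA where nA: "\<And>n x :: nat. nA \<le> n \<Longrightarrow> x \<le> n \<Longrightarrow> \<alpha> * x - \<epsilon> / 3 * n \<le> card (A \<inter> {1..int x})"
        using lower_density_count[OF A(1) less_imp_le[OF A(2)] e] by blast
      obtain nB where nB: "\<And>n x :: nat. nB \<le> n \<Longrightarrow> x \<le> n \<Longrightarrow> \<beta> * x - \<epsilon> / 3 * n \<le> card (B \<inter> {1..int x})"
        using lower_density_count[OF B(1) less_imp_le[OF B(2)] e] by blast
      obtain n1 where n1: "\<And>n. n1 \<le> n \<Longrightarrow> n \<in> S \<Longrightarrow> real (cA L n + cB L n) < (\<Phi> + \<epsilon> / 3) * real n"
        using finally_small[OF e, of L] by blast
      obtain n where n: "max (max n0 n1) (max (max nA nB) (nat \<lceil>L / \<epsilon>\<rceil>)) \<le> n" "n \<in> S"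
        using S unfolding infinite_nat_iff_unbounded_le by blast
      have "L / \<epsilon> \<le> n" using n(1) by linarith
      then have Ln: "L \<le> \<epsilon> * n" using \<epsilon>(2) by (simp add: field_simps)
      have "real (cA L n + cB L n) < (\<Phi> + \<epsilon> / 3) * real n" using n by (intro n1) auto
      also have "\<dots> \<le> (\<alpha> + \<beta> + \<epsilon> / 3) * real n" using False by (intro mult_right_mono) auto
      finally have up: "real (cA L n) + real (cB L n) \<le> \<alpha> * n + \<beta> * n + \<epsilon> / 3 * n" by (simp add: algebra_simps)
      have lowA: "\<alpha> * x - \<epsilon> / 3 * n \<le> card (A \<inter> {1..int x})"
        and lowB: "\<beta> * x - \<epsilon> / 3 * n \<le> card (B \<inter> {1..int x})" if "x \<le> n" for x
        using nA[of n x] nB[of n x] that n(1) by auto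
      have pos: "0 \<le> \<epsilon> * n" using \<epsilon> by simp
      \<comment> \<open>The three thirds of \<epsilon> come from the upper bound for the thickened
        counts, the lower bound for the other set and the lower bound for the set itself.\<close>
      have fat: "cA L n \<le> card (A \<inter> {1..int n}) + \<epsilon> * n" "cB L n \<le> card (B \<inter> {1..int n}) + \<epsilon> * n"
        using up lowA[of n] lowB[of n] c0(1)[of n L] c0(2)[of n L] by linarith+
      have "(min (\<alpha> + \<beta>) 1 - 14 * \<tau>) * n \<le> card (thick_points n k (A + B))"
      proof (rule sumset_thick_points(1)[OF \<tau>(1-4) \<epsilon>(1) L Ln])
        fix x assume "x \<le> n"
        then show "\<alpha> * x - \<epsilon> * n \<le> card (A \<inter> {1..int x})" "\<beta> * x - \<epsilon> * n \<le> card (B \<inter> {1..int x})"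
          using lowA[of x] lowB[of x] pos by linarith+
      qed (use fat in \<open>simp_all only: cA_def cB_def\<close>)
      moreover have "(\<alpha> + \<beta> - \<delta>) * n \<le> (min (\<alpha> + \<beta>) 1 - 14 * \<tau>) * n"
        using \<tau>(5) assms(5) by (intro mult_right_mono) auto
      ultimately show ?thesis using n by (intro exI[of _ n]) (auto simp flip: set_zero)
    qed
    then show ?thesis by blast
  qed
qed

section \<open>Densities with sum at least 1\<close>

text \<open>Between a new point x of A + [-L, L] and a nearby element of A there is a point g
  outside A but adjacent to A, which radius 1 already adds. It is less than L away from x, so each g
  serves fewer than 3 L points. Positivity of A keeps g in [1, n + L], and the summand L allows for
  g beyond n.\<close>

lemma card_thicken_le:
  fixes A :: "int set"
  assumes "A \<subseteq> {1..}" "0 < L"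
  shows "card ((A + {- int L..int L}) \<inter> {1..int n}) \<le> card (A \<inter> {1..int n}) +
    3 * L * (card ((A + {- int 1..int 1}) \<inter> {1..int n}) - card (A \<inter> {1..int n}) + L)"
proof -
  let ?A1 = "A + {- int 1..int 1}" and ?AL = "A + {- int L..int L}"
  let ?G = "(?A1 - A) \<inter> {1..int (n + L)}"
  have up: "\<exists>g\<ge>x. g < x + int j \<and> g \<notin> A \<and> g + 1 \<in> A" if "x \<notin> A" "x + int j \<in> A" for x j
    using that(2)
  proof (induction j)
    case (Suc j)
    show ?case
    proof (cases "x + int j \<in> A")
      case False
      then show ?thesis using Suc.prems by (intro exI[of _ "x + int j"]) (auto simp: ac_simps)
    qed (use Suc.IH in fastforce)
  qed (use that in simp)
  have down: "\<exists>g\<le>x. x - int j < g \<and> g \<notin> A \<and> g - 1 \<in> A" if "x \<notin> A" "x - int j \<in> A" for x j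
    using that(2)
  proof (induction j)
    case (Suc j)
    show ?case
    proof (cases "x - int j \<in> A")
      case False
      then show ?thesis using Suc.prems by (intro exI[of _ "x - int j"]) (auto simp: algebra_simps)
    qed (use Suc.IH in fastforce)
  qed (use that in simp)
  have A1: "g \<in> ?A1" if "g + 1 \<in> A \<or> g - 1 \<in> A" for g
    using set_plus_intro[of "g + 1" A "- 1" "{- int 1..int 1}"]
      set_plus_intro[of "g - 1" A 1 "{- int 1..int 1}"] that by auto
  have "?AL \<inter> {1..int n} - A \<inter> {1..int n} \<subseteq> (\<lambda>(g, t). g + t) ` (?G \<times> {- int L<..<int L})"
  proof
    fix x assume "x \<in> ?AL \<inter> {1..int n} - A \<inter> {1..int n}"
    then obtain a t where x: "x = a + t" "a \<in> A" "t \<in> {- int L..int L}" "x \<notin> A" "1 \<le> x" "x \<le> int n"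
      by (auto elim!: set_plus_elim)
    have "\<exists>g\<in>?G. \<bar>x - g\<bar> < int L"
    proof (cases "t \<le> 0")
      case True
      then obtain g where "x \<le> g" "g < a" "g \<notin> A" "g + 1 \<in> A"
        using up[of x "nat (- t)"] x by auto
      then show ?thesis using A1[of g] x by (intro bexI[of _ g]) auto
    next
      case False
      then obtain g where g: "g \<le> x" "a < g" "g \<notin> A" "g - 1 \<in> A"
        using down[of x "nat t"] x by auto
      moreover have "1 \<le> a" using x(2) assms(1) by auto
      ultimately show ?thesis using A1[of g] x by (intro bexI[of _ g]) auto
    qed
    then obtain g where "g \<in> ?G" "\<bar>x - g\<bar> < int L" by blast
    then show "x \<in> (\<lambda>(g, t). g + t) ` (?G \<times> {- int L<..<int L})"
      by (intro image_eqI[of _ _ "(g, x - g)"]) auto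
  qed
  then have "card (?AL \<inter> {1..int n} - A \<inter> {1..int n}) \<le> card ((\<lambda>(g, t). g + t) ` (?G \<times> {- int L<..<int L}))"
    by (intro card_mono) auto
  also have "\<dots> \<le> card (?G \<times> {- int L<..<int L})" by (intro card_image_le) auto
  also have "\<dots> = card ?G * card {- int L<..<int L}" by (rule card_cartesian_product)
  also have "card {- int L<..<int L} \<le> 3 * L" by (simp add: nat_le_iff)
  also have "card ?G \<le> card ((?A1 \<inter> {1..int n} - A \<inter> {1..int n}) \<union> {int n + 1..int n + int L})"
    by (intro card_mono) auto
  also have "\<dots> \<le> card (?A1 \<inter> {1..int n} - A \<inter> {1..int n}) + L"
    using card_Un_le[of "?A1 \<inter> {1..int n} - A \<inter> {1..int n}" "{int n + 1..int n + int L}"] by simp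
  also have "card (?A1 \<inter> {1..int n} - A \<inter> {1..int n}) = card (?A1 \<inter> {1..int n}) - card (A \<inter> {1..int n})"
    using subset_thicken[of A 1] by (intro card_Diff_subset) auto
  finally have "card (?AL \<inter> {1..int n} - A \<inter> {1..int n}) \<le>
      3 * L * (card (?A1 \<inter> {1..int n}) - card (A \<inter> {1..int n}) + L)" by (simp add: mult.commute)
  moreover have "card (?AL \<inter> {1..int n} - A \<inter> {1..int n}) = card (?AL \<inter> {1..int n}) - card (A \<inter> {1..int n})"
    using subset_thicken[of A L] by (intro card_Diff_subset) auto
  ultimately show ?thesis by linarith
qed

text \<open>X \<inter> [1, u] and the reflection of Y \<inter> [1, u] in u both lie in [0, u], which
  has u + 1 points, so they meet.\<close>

lemma sumset_pigeonhole:
  fixes X Y :: "int set"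
  assumes "0 \<le> u" "u + 1 < int (card (X \<inter> {1..u}) + card (Y \<inter> {1..u}))"
  shows "u \<in> X + Y"
proof (rule ccontr)
  assume "u \<notin> X + Y"
  let ?P = "X \<inter> {1..u}" and ?Q = "(\<lambda>y. u - y) ` (Y \<inter> {1..u})"
  have "x + y \<noteq> u" if "x \<in> X" "y \<in> Y" for x y
    using set_plus_intro[OF that] \<open>u \<notin> X + Y\<close> by auto
  then have "?P \<inter> ?Q = {}" by force
  then have "card (?P \<union> ?Q) = card ?P + card ?Q" by (intro card_Un_disjoint) auto
  moreover have "card ?Q = card (Y \<inter> {1..u})" by (intro card_image) (auto simp: inj_on_def)
  moreover have "card (?P \<union> ?Q) \<le> card {0..u}" by (intro card_mono) auto
  ultimately show False using assms by simp
qed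

text \<open>By \<open>card_thicken_le\<close>, growth at radius 1 controls growth at every radius L,
  so only counts at radius 1 need watching. The radius 2 is the sum of two radii 1 and does not
  depend on k.\<close>

lemma sumset_syndetic_full:
  fixes A B :: "int set" and \<alpha> \<beta> \<delta> :: real
  assumes A: "A \<subseteq> {1..}" "lower_density A = ereal \<alpha>" "0 < \<alpha>"
    and B: "B \<subseteq> {1..}" "lower_density B = ereal \<beta>" "0 < \<beta>"
    and "1 \<le> \<alpha> + \<beta>" "0 < \<delta>"
  shows "\<exists>n0. \<forall>n\<ge>n0. (1 - \<delta>) * real n \<le> card (thick_points n k (A + B + {- int 2..int 2}))"
proof -
  let ?W = "A + B + {- int 2..int 2}" and ?A1 = "A + {- int 1..int 1}" and ?B1 = "B + {- int 1..int 1}"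
  define \<tau> where "\<tau> = Min {\<alpha> / 2, \<beta> / 2, 1, \<delta> / 28}"
  have \<tau>: "0 < \<tau>" "\<tau> \<le> 1" "\<tau> < \<alpha>" "\<tau> < \<beta>" "28 * \<tau> \<le> \<delta>"
    using A(3) B(3) assms(8) by (auto simp: \<tau>_def min_def)
  define \<epsilon> where "\<epsilon> = \<tau> ^ 3 / 4"
  have \<epsilon>: "4 * \<epsilon> = \<tau> ^ 3" "0 < \<epsilon>" using \<tau> by (auto simp: \<epsilon>_def)
  obtain L :: nat where L: "2 * real k + 6 \<le> \<tau> * real L"
    using real_arch_simple[of "(2 * real k + 6) / \<tau>"] \<tau>(1) by (auto simp: field_simps)
  then have "0 < \<tau> * real L" by linarith
  then have L0: "0 < L" using \<tau>(1) by (simp add: zero_less_mult_iff)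
  \<comment> \<open>Chosen so that, at a point z with few surplus elements, thickening A or B by L costs at most
    \<open>3 L (\<eta> n + 2 e z + L) \<le> \<epsilon> z\<close>.\<close>
  define e where "e = \<epsilon> / (24 * L)"
  define \<eta> where "\<eta> = \<delta> * \<epsilon> / (48 * L)"
  have e: "0 < e" "12 * L * e * 2 = \<epsilon>" "e \<le> \<epsilon>" and \<eta>: "0 < \<eta>" "48 * L * \<eta> = \<delta> * \<epsilon>"
    using L0 \<epsilon> assms(8) by (auto simp: e_def \<eta>_def field_simps)
  obtain nA where nA: "\<And>n x :: nat. nA \<le> n \<Longrightarrow> x \<le> n \<Longrightarrow> \<alpha> * x - e * n \<le> card (A \<inter> {1..int x})"
    using lower_density_count[OF A(2) less_imp_le[OF A(3)] e(1)] by blast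
  obtain nB where nB: "\<And>n x :: nat. nB \<le> n \<Longrightarrow> x \<le> n \<Longrightarrow> \<beta> * x - e * n \<le> card (B \<inter> {1..int x})"
    using lower_density_count[OF B(2) less_imp_le[OF B(3)] e(1)] by blast
  define z1 where "z1 = max (max nA nB) (nat \<lceil>12 * L * L / \<epsilon>\<rceil>)"
  have initial: "(1 - \<delta> / 2) * real z \<le> card (thick_points z k (A + B))"
    if z: "z1 \<le> z" and few: "card (?A1 \<inter> {1..int z}) + card (?B1 \<inter> {1..int z}) \<le> z + \<eta> * n"
      and n: "\<delta> / 4 * n \<le> z" for z n :: nat
  proof -
    have z': "nA \<le> z" "nB \<le> z" "12 * L * L / \<epsilon> \<le> z" using z unfolding z1_def by linarith+
    then have Lz: "12 * (L * L) \<le> \<epsilon> * z" using \<epsilon>(2) by (simp add: field_simps)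
    have "real L \<le> 12 * (L * L)" using L0 by (simp add: field_simps)
    with Lz have Lz': "L \<le> \<epsilon> * z" by linarith
    have ez: "e * z \<le> \<epsilon> * z" using e(3) by (intro mult_right_mono) auto
    \<comment> \<open>Because \<alpha> + \<beta> \<ge> 1, the counts of A and B up to z add up to at
      least z - 2 e z. The bound \<open>few\<close> therefore lets each set grow by at most \<eta> n
      + 2 e z at radius 1.\<close>
    have "card (A \<inter> {1..int z}) \<le> card (?A1 \<inter> {1..int z})" "card (B \<inter> {1..int z}) \<le> card (?B1 \<inter> {1..int z})"
      using subset_thicken[of A 1] subset_thicken[of B 1] by (auto intro!: card_mono)
    moreover have "z \<le> \<alpha> * z + \<beta> * z"
      using mult_right_mono[OF assms(7), of "real z"] by (simp add: distrib_right)
    moreover note nA[of z z] nB[of z z]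
    ultimately have D: "real (card (?A1 \<inter> {1..int z}) - card (A \<inter> {1..int z})) \<le> \<eta> * n + 2 * (e * z)"
      "real (card (?B1 \<inter> {1..int z}) - card (B \<inter> {1..int z})) \<le> \<eta> * n + 2 * (e * z)"
      using few z' by (simp_all add: of_nat_diff)
    have "12 * L * \<eta> * n = 48 * L * \<eta> * n / 4" by simp
    also have "\<dots> = \<epsilon> * (\<delta> / 4 * n)" unfolding \<eta>(2) by simp
    also have "\<dots> \<le> \<epsilon> * z" using n \<epsilon>(2) by (intro mult_left_mono) auto
    finally have "12 * (L * (\<eta> * n)) \<le> \<epsilon> * z" by simp
    moreover have "24 * (L * (e * z)) = \<epsilon> * z" using e(2) by (simp add: algebra_simps)
    moreover have "3 * L * (\<eta> * n + 2 * (e * z) + L) = 3 * (L * (\<eta> * n)) + 6 * (L * (e * z)) + 3 * (L * L)"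
      by (simp add: algebra_simps)
    ultimately have bound: "3 * L * (\<eta> * n + 2 * (e * z) + L) \<le> \<epsilon> * z" using Lz by linarith
    have fat: "card ((C + {- int L..int L}) \<inter> {1..int z}) \<le> card (C \<inter> {1..int z}) + \<epsilon> * z"
      if "C \<subseteq> {1..}" "real (card ((C + {- int 1..int 1}) \<inter> {1..int z}) - card (C \<inter> {1..int z})) \<le> \<eta> * n + 2 * (e * z)" for C
    proof -
      have "3 * L * (real (card ((C + {- int 1..int 1}) \<inter> {1..int z}) - card (C \<inter> {1..int z})) + L)
          \<le> 3 * L * (\<eta> * n + 2 * (e * z) + L)"
        using that(2) by (intro mult_left_mono) auto
      moreover have "real (card ((C + {- int L..int L}) \<inter> {1..int z})) \<le> real (card (C \<inter> {1..int z}) +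
          3 * L * (card ((C + {- int 1..int 1}) \<inter> {1..int z}) - card (C \<inter> {1..int z}) + L))"
        by (intro of_nat_mono card_thicken_le that(1) L0)
      ultimately show ?thesis using bound by simp
    qed
    have "(min (\<alpha> + \<beta>) 1 - 14 * \<tau>) * z \<le> card (thick_points z k (A + B))"
    proof (rule sumset_thick_points(1)[OF \<tau>(1-4) \<epsilon>(1) L Lz'])
      fix x assume "x \<le> z"
      then show "\<alpha> * x - \<epsilon> * z \<le> card (A \<inter> {1..int x})" "\<beta> * x - \<epsilon> * z \<le> card (B \<inter> {1..int x})"
        using nA[of z x] nB[of z x] z' ez by linarith+
    qed (use fat[OF A(1) D(1)] fat[OF B(1) D(2)] in simp_all)
    moreover have "(1 - \<delta> / 2) * z \<le> (min (\<alpha> + \<beta>) 1 - 14 * \<tau>) * z"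
      using \<tau>(5) assms(7) by (intro mult_right_mono) auto
    ultimately show ?thesis by linarith
  qed
  have W: "?W = ?A1 + ?B1"
    using interval_plus_interval[of 1 1] by (simp add: ac_simps flip: interval_plus_interval[of 1 1])
  show ?thesis
  proof (intro exI allI impI)
    fix n assume n: "max (nat \<lceil>1 / \<eta>\<rceil>) (nat \<lceil>4 * max (2 * k) z1 / \<delta>\<rceil>) \<le> n"
    have "1 / \<eta> \<le> n" "4 * max (2 * k) z1 / \<delta> \<le> n" using n by linarith+
    then have n': "1 \<le> \<eta> * n" "max (2 * k) z1 \<le> \<delta> / 4 * n"
      using \<eta>(1) assms(8) by (simp_all add: field_simps)
    \<comment> \<open>0 lies in \<open>Z\<close>, so a last z exists. Past it the counts exceed u +
      \<eta> n, and \<eta> n \<ge> 1 supplies the margin that \<open>sumset_pigeonhole\<close> asks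
      for.\<close>
    define Z where "Z = {z \<in> {..n}. card (?A1 \<inter> {1..int z}) + card (?B1 \<inter> {1..int z}) \<le> z + \<eta> * n}"
    define z where "z = Max Z"
    have Z: "finite Z" "0 \<in> Z" using n'(1) by (auto simp: Z_def)
    then have "z \<in> Z" unfolding z_def by (intro Max_in) auto
    then have z: "z \<le> n" "card (?A1 \<inter> {1..int z}) + card (?B1 \<inter> {1..int z}) \<le> z + \<eta> * n" by (auto simp: Z_def)
    have beyond: "u \<in> ?W" if "int z < u" "u \<le> int n" for u
    proof -
      have "nat u \<notin> Z" using Max_ge[OF Z(1), of "nat u"] that unfolding z_def[symmetric] by auto
      then have "real_of_int u + \<eta> * n < real (card (?A1 \<inter> {1..u}) + card (?B1 \<inter> {1..u}))"
        using that by (auto simp: Z_def)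
      then have "u + 1 < int (card (?A1 \<inter> {1..u}) + card (?B1 \<inter> {1..u}))" using n'(1) by linarith
      then show ?thesis unfolding W using that by (intro sumset_pigeonhole) auto
    qed
    \<comment> \<open>Up to z the thick points come from A + B itself; beyond z all of [1, n] lies
      in \<open>?W\<close>, and only points within k of z or of n are given up.\<close>
    have "thick_points z k (A + B) \<union> {int z + int k + 1..int n - int k} \<subseteq> thick_points n k ?W"
      using z(1) subset_thicken[of "A + B" 2] beyond
      by (auto simp: thick_points_def elt_set_plus_def subset_iff)
    then have "card (thick_points z k (A + B) \<union> {int z + int k + 1..int n - int k}) \<le> card (thick_points n k ?W)"
      by (intro card_mono) auto
    moreover have "card (thick_points z k (A + B) \<union> {int z + int k + 1..int n - int k}) =
        card (thick_points z k (A + B)) + card {int z + int k + 1..int n - int k}"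
    proof (rule card_Un_disjoint)
      show "thick_points z k (A + B) \<inter> {int z + int k + 1..int n - int k} = {}"
        by (auto simp: thick_points_def)
    qed simp_all
    ultimately have total: "card (thick_points z k (A + B)) + (real n - z - 2 * k) \<le> card (thick_points n k ?W)"
      by simp
    \<comment> \<open>An initial part of length at most (\<delta> / 4) n is discarded; a longer one
      is handled by \<open>initial\<close>.\<close>
    have "real z - \<delta> / 2 * n \<le> card (thick_points z k (A + B)) \<or> real z \<le> \<delta> / 4 * n"
    proof (cases "\<delta> / 4 * n \<le> z")
      case True
      then have "(1 - \<delta> / 2) * real z \<le> card (thick_points z k (A + B))"
        using n'(2) z(2) by (intro initial[of z n]) auto
      moreover have "\<delta> / 2 * z \<le> \<delta> / 2 * n" using z(1) assms(8) by (intro mult_left_mono) auto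
      ultimately show ?thesis by (simp add: left_diff_distrib)
    qed simp
    moreover have "2 * k \<le> \<delta> / 4 * n" "0 \<le> \<delta> / 4 * n" using n'(2) assms(8) by auto
    ultimately show "(1 - \<delta>) * real n \<le> card (thick_points n k ?W)"
      using total by (auto simp: left_diff_distrib)
  qed
qed

theorem theorem5p2:
  fixes A B :: "int set" and \<alpha> \<beta> :: real
  assumes "A \<subseteq> {1..}" and "B \<subseteq> {1..}"
    and "lower_density A = ereal \<alpha>" and "\<alpha> > 0"
    and "lower_density B = ereal \<beta>" and "\<beta> > 0"
  shows "strongly_upper_syndetic (min (\<alpha> + \<beta>) 1) (A + B)"
  unfolding strongly_upper_syndetic_def
proof (intro conjI allI impI)
  show "A + B \<subseteq> {1..}" using assms(1,2) by (fastforce elim!: set_plus_elim)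
  fix S :: "nat set" assume S: "infinite S \<and> S \<subseteq> {1..}"
  \<comment> \<open>One m serves all k and \<delta>, as the order of quantifiers in
    \<open>strongly_upper_syndetic\<close> demands; \<open>Limsup_thick_points_ge\<close> then
    removes \<delta>.\<close>
  have "\<exists>m. \<forall>k \<delta> n0. 0 < \<delta> \<longrightarrow> (\<exists>n\<ge>n0. n \<in> S \<and>
    (min (\<alpha> + \<beta>) 1 - \<delta>) * real n \<le> card (thick_points n k (A + B + {- int m..int m})))"
  proof (cases "\<alpha> + \<beta> < 1")
    case True
    then show ?thesis using sumset_upper_syndetic[OF assms(3,4,5,6) True, of S] S by (simp add: min_def)
  next
    case False
    have "\<exists>n\<ge>n0. n \<in> S \<and> (min (\<alpha> + \<beta>) 1 - \<delta>) * real n \<le> card (thick_points n k (A + B + {- int 2..int 2}))"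
      if \<delta>: "0 < \<delta>" for k \<delta> n0
    proof -
      obtain n1 where "\<And>n. n1 \<le> n \<Longrightarrow> (1 - \<delta>) * real n \<le> card (thick_points n k (A + B + {- int 2..int 2}))"
        using sumset_syndetic_full[OF assms(1,3,4,2,5,6) _ \<delta>] False by force
      moreover obtain n where "max n0 n1 \<le> n" "n \<in> S"
        using S unfolding infinite_nat_iff_unbounded_le by blast
      ultimately show ?thesis using False by (intro exI[of _ n]) auto
    qed
    then show ?thesis by blast
  qed
  then obtain m where "\<And>k \<delta> n0. 0 < \<delta> \<Longrightarrow> \<exists>n\<ge>n0. n \<in> S \<and>
    (min (\<alpha> + \<beta>) 1 - \<delta>) * real n \<le> card (thick_points n k (A + B + {- int m..int m}))" by blast
  then have "ereal (min (\<alpha> + \<beta>) 1) \<le> Limsup (inf sequentially (principal S))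
      (\<lambda>n. ereal (1 / real n * real (card (thick_points n k (A + B + {- int m..int m})))))" for k
    by (rule Limsup_thick_points_ge)
  then show "\<exists>m. \<forall>k\<ge>1. ereal (min (\<alpha> + \<beta>) 1) \<le> Limsup (inf sequentially (principal S))
      (\<lambda>n. ereal (1 / real n * real (card
        {z \<in> {1..int n}. z +o {- int k..int k} \<subseteq> A + B + {- int m..int m}})))"
    unfolding thick_points_def by blast
qed (use assms in auto)

end
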